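(* For each $N\in\mathbb{N}$, $N\ge 3$, let $\Omega_N\subseteq\mathbb{R}^2$ denote the regular polygon with $N$ sides circumscribed by the unit disc $B(0,1)$ (that is, centred at the origin, with its vertices on the unit circle). Denote by $u_N$ the unique function in $W^{1,2}_0(\Omega_N)$ with $\Delta u_N=-1$ in $\Omega_N$. Then for each $\beta\in(0,1)$, $$\int_{\Omega_N}u_N(x)^{-\beta}\,dx=\frac{4^\beta\pi}{1-\beta}+\mathcal{O}(N^{\beta-1})\qquad\text{as }N\to\infty.$$
   Context: $\Omega_N$ is regarded as an open set. *)

theory Defs
  imports "HOL-Analysis.Analysis" "HOL-Library.Landau_Symbols"
begin

text \<open>A function is of class \<open>C^(k+1)\<close> iff it is differentiable everywhere and all its first-order
  partial derivatives are of class \<open>C^k\<close>.\<close>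

primrec C_k :: "nat \<Rightarrow> ('a::euclidean_space \<Rightarrow> real) \<Rightarrow> bool" where
  "C_k 0 f \<longleftrightarrow> continuous_on UNIV f"
| "C_k (Suc k) f \<longleftrightarrow>
     (\<forall>x. f differentiable (at x)) \<and> (\<forall>b\<in>Basis. C_k k (\<lambda>x. frechet_derivative f (at x) b))"

text \<open>The space \<open>C_c^\<infinity>(\<Omega>)\<close>, its elements being extended by zero to the whole space.\<close>

definition test_functions :: "'a::euclidean_space set \<Rightarrow> ('a \<Rightarrow> real) set" where
  "test_functions \<Omega> = {\<phi>. (\<forall>k. C_k k \<phi>) \<and> compact (closure {x. \<phi> x \<noteq> 0}) \<and>
     closure {x. \<phi> x \<noteq> 0} \<subseteq> \<Omega>}"

definition grad :: "('a::euclidean_space \<Rightarrow> real) \<Rightarrow> 'a \<Rightarrow> 'a" where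
  "grad f x = (\<Sum>b\<in>Basis. frechet_derivative f (at x) b *\<^sub>R b)"

definition L2_on :: "'a::euclidean_space set \<Rightarrow> ('a \<Rightarrow> 'b::euclidean_space) set" where
  "L2_on \<Omega> = {f. set_borel_measurable lebesgue \<Omega> f \<and>
     set_integrable lebesgue \<Omega> (\<lambda>x. (norm (f x))\<^sup>2)}"

text \<open>Functions are not identified when they agree almost everywhere, so the weak gradient of \<open>u\<close>
  is a relation; it determines \<open>g\<close> up to null sets. Values outside \<open>\<Omega>\<close> are irrelevant.\<close>

definition has_weak_gradient_L2 ::
    "'a::euclidean_space set \<Rightarrow> ('a \<Rightarrow> real) \<Rightarrow> ('a \<Rightarrow> 'a) \<Rightarrow> bool" where
  "has_weak_gradient_L2 \<Omega> u g \<longleftrightarrow> u \<in> L2_on \<Omega> \<and> g \<in> L2_on \<Omega> \<and>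
     (\<forall>\<phi>\<in>test_functions \<Omega>. \<forall>b\<in>Basis.
        (LINT x:\<Omega>|lebesgue. u x * frechet_derivative \<phi> (at x) b)
          = - (LINT x:\<Omega>|lebesgue. (g x \<bullet> b) * \<phi> x))"

definition W12 :: "'a::euclidean_space set \<Rightarrow> ('a \<Rightarrow> real) set" where
  "W12 \<Omega> = {u. \<exists>g. has_weak_gradient_L2 \<Omega> u g}"

text \<open>\<open>W^(1,2)_0(\<Omega>)\<close>: the closure of \<open>C_c^\<infinity>(\<Omega>)\<close> in the norm of \<open>W^(1,2)(\<Omega>)\<close>.\<close>

definition W12_0 :: "'a::euclidean_space set \<Rightarrow> ('a \<Rightarrow> real) set" where
  "W12_0 \<Omega> = {u \<in> W12 \<Omega>. \<forall>g. has_weak_gradient_L2 \<Omega> u g \<longrightarrow>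
     (\<exists>\<phi> :: nat \<Rightarrow> 'a \<Rightarrow> real. (\<forall>n. \<phi> n \<in> test_functions \<Omega>) \<and>
        (\<lambda>n. (LINT x:\<Omega>|lebesgue. (\<phi> n x - u x)\<^sup>2)
            + (LINT x:\<Omega>|lebesgue. (norm (grad (\<phi> n) x - g x))\<^sup>2)) \<longlonglongrightarrow> 0)}"

text \<open>\<open>\<Delta>u = f\<close> in \<open>\<Omega>\<close> in the weak sense, for \<open>u\<close> in \<open>W^(1,2)(\<Omega>)\<close>.\<close>

definition weak_laplacian ::
    "'a::euclidean_space set \<Rightarrow> ('a \<Rightarrow> real) \<Rightarrow> ('a \<Rightarrow> real) \<Rightarrow> bool" where
  "weak_laplacian \<Omega> u f \<longleftrightarrow> u \<in> W12 \<Omega> \<and> (\<forall>g. has_weak_gradient_L2 \<Omega> u g \<longrightarrow>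
     (\<forall>\<phi>\<in>test_functions \<Omega>.
        (LINT x:\<Omega>|lebesgue. g x \<bullet> grad \<phi> x) = - (LINT x:\<Omega>|lebesgue. f x * \<phi> x)))"

text \<open>The open regular \<open>N\<close>-gon centred at the origin with vertices on the unit circle; such a polygon
  is determined up to a rotation, recorded by the angle \<open>\<theta>\<close> of one of its vertices.\<close>

definition regular_polygon :: "real \<Rightarrow> nat \<Rightarrow> (real ^ 2) set" where
  "regular_polygon \<theta> N = interior (convex hull
     ((\<lambda>k. vector [cos (\<theta> + 2 * pi * real k / real N), sin (\<theta> + 2 * pi * real k / real N)]) ` {..<N}))"

end

theory Submission
  imports Defs
begin

text \<open>On the polygon with inradius \<open>c = cos (\<pi>/N)\<close> the solution is squeezed between explicit
  paraboloids: \<open>u \<le> (1 - \<bar>x\<bar>\<^sup>2)/4\<close>, and \<open>u \<ge> (r\<^sup>2 - \<bar>x - y\<bar>\<^sup>2)/4\<close> for every ball \<open>B(y,r)\<close> inside the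
  polygon. The incircle gives the main term up to \<open>O(N\<^sup>2\<^sup>\<beta>\<^sup>-\<^sup>2)\<close>. Outside it, the incircle shrunk
  towards a vertex gives \<open>u \<ge> (c/4) d (1 - \<bar>y\<bar>/\<sigma>)\<close>, where \<open>d\<close> is the distance to the nearest side, \<open>y\<close> the
  coordinate along it and \<open>\<sigma>\<close> half its length; the \<open>-\<beta>\<close> power of this product is integrated over a
  rectangle of width \<open>2\<sigma>\<close> and height \<open>\<sigma>\<^sup>2/c\<close> at each side.

  Comparison needs no calculus of Sobolev functions: if the test functions \<open>\<phi>\<^sub>n\<close> tend to \<open>u\<close> and \<open>v\<close> is a
  smooth strict sub- or supersolution, then \<open>H(\<plusminus>(v - \<phi>\<^sub>n))\<close> with a smooth nondecreasing \<open>H\<close> vanishing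
  on the negative axis is itself a test function, and its integral tends to zero.\<close>

subsection \<open>Smooth functions\<close>

text \<open>The integrand blows up along the whole boundary, so bounding the integral from above
  needs a lower barrier up to every boundary point. Shrunk incircles give one that is linear in
  \<open>d\<close>, but their radii tend to 0 at the vertices; the factor
  \<open>1 - \<bar>y\<bar>/\<sigma>\<close> is that loss. Both factors vanish only linearly, so
  their powers are integrable because \<open>\<beta> < 1\<close>, and they depend on orthogonal
  coordinates, so Tonelli applies. One side costs order \<open>\<sigma>^(3 - 2 * \<beta>)\<close>:
  \<open>\<sigma>^\<beta>\<close> from the slope, \<open>\<sigma>^(2 - 2 * \<beta>)\<close> from the
  normal and \<open>\<sigma>^(1 - \<beta>)\<close> from the tangential variable. With
  \<open>N\<close> sides and \<open>\<sigma> \<le> pi / N\<close> the total is again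
  \<open>O(N^(2 * \<beta> - 2))\<close>; the claimed exponent \<open>\<beta> - 1\<close> is weaker
  and is reached through \<open>\<sigma>^2 \<le> pi^2 / N\<close>. The paraboloids have Laplacian
  exactly -1, so the strictness needed for comparison is created by a scalar factor and removed in a
  limit. Each comparison holds off a null set that depends on the ball, while the ball used varies
  with the point; rational parameters and continuity repair this.\<close>

lemma C_k_imp_continuous_on:
  assumes "C_k k f"
  shows "continuous_on UNIV f"
proof (cases k)
  case 0
  with assms show ?thesis by simp
next
  case (Suc n)
  then have "f differentiable (at x)" for x using assms by simp
  then show ?thesis
    by (intro continuous_at_imp_continuous_on ballI differentiable_imp_continuous_within)
qed

text \<open>The product and chain rules multiply a function by partial derivatives, so in the
  inductions below both must be available at the same level \<open>k\<close>.\<close>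

lemma C_k_Suc_imp: "C_k (Suc k) f \<Longrightarrow> C_k k f"
proof (induction k arbitrary: f)
  case 0
  then show ?case using C_k_imp_continuous_on[of "Suc 0" f] by simp
next
  case (Suc k)
  have "f differentiable (at x)" for x using Suc.prems by simp
  moreover have "C_k k (\<lambda>x. frechet_derivative f (at x) b)" if "b \<in> Basis" for b
    using Suc.prems that by (intro Suc.IH) simp
  ultimately show ?case by simp
qed

lemma C_k_const: "C_k k (\<lambda>_. c)"
  by (induction k arbitrary: c) (auto simp: frechet_derivative_const)

lemma frechet_derivative_add:
  fixes f g :: "'a::real_normed_vector \<Rightarrow> 'b::real_normed_vector"
  assumes "f differentiable (at x)" "g differentiable (at x)"
  shows "frechet_derivative (\<lambda>x. f x + g x) (at x) b
      = frechet_derivative f (at x) b + frechet_derivative g (at x) b"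
proof -
  have "((\<lambda>x. f x + g x) has_derivative
     (\<lambda>h. frechet_derivative f (at x) h + frechet_derivative g (at x) h)) (at x)"
    using assms by (intro has_derivative_add) (auto simp: frechet_derivative_works)
  from fun_cong[OF frechet_derivative_at[OF this], of b] show ?thesis by simp
qed

lemma C_k_add:
  "C_k k f \<Longrightarrow> C_k k g \<Longrightarrow> C_k k (\<lambda>x. f x + g x)"
proof (induction k arbitrary: f g)
  case 0 then show ?case by (auto intro!: continuous_intros)
next
  case (Suc k)
  have "frechet_derivative (\<lambda>x. f x + g x) (at x) b
      = frechet_derivative f (at x) b + frechet_derivative g (at x) b" for x b
    using Suc.prems by (intro frechet_derivative_add) auto
  with Suc show ?case by auto
qed

lemma frechet_derivative_mult:
  fixes f g :: "'a::real_normed_vector \<Rightarrow> real"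
  assumes "f differentiable (at x)" "g differentiable (at x)"
  shows "frechet_derivative (\<lambda>x. f x * g x) (at x) b
      = f x * frechet_derivative g (at x) b + frechet_derivative f (at x) b * g x"
proof -
  have "((\<lambda>x. f x * g x) has_derivative
     (\<lambda>h. f x * frechet_derivative g (at x) h + frechet_derivative f (at x) h * g x)) (at x)"
    using assms by (intro has_derivative_mult) (auto simp: frechet_derivative_works)
  from fun_cong[OF frechet_derivative_at[OF this], of b] show ?thesis by simp
qed

lemma C_k_mult:
  "C_k k f \<Longrightarrow> C_k k g \<Longrightarrow> C_k k (\<lambda>x. f x * g x)"
proof (induction k arbitrary: f g)
  case 0 then show ?case by (auto intro!: continuous_intros)
next
  case (Suc k)
  have "C_k k (\<lambda>x. f x * frechet_derivative g (at x) b + frechet_derivative f (at x) b * g x)"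
    if "b \<in> Basis" for b
    using Suc.prems Suc.prems[THEN C_k_Suc_imp] that by (intro C_k_add Suc.IH) auto
  with Suc.prems show ?case by (auto simp: frechet_derivative_mult)
qed

lemma frechet_derivative_inner_left: "frechet_derivative (\<lambda>x. x \<bullet> c) (at x) b = b \<bullet> c"
proof -
  have "((\<lambda>x. x \<bullet> c) has_derivative (\<lambda>h. h \<bullet> c)) (at x)" by (auto intro!: derivative_eq_intros)
  from fun_cong[OF frechet_derivative_at[OF this], of b] show ?thesis by simp
qed

lemma C_k_inner: "C_k k (\<lambda>x::'a::euclidean_space. x \<bullet> c)"
proof (cases k)
  case 0 then show ?thesis by (auto intro!: continuous_intros)
next
  case (Suc n)
  have "(\<lambda>x. x \<bullet> c) differentiable (at x)" for x :: 'a
    by (auto intro!: derivative_eq_intros simp: differentiable_def)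
  then show ?thesis using Suc C_k_const by (auto simp: frechet_derivative_inner_left)
qed

lemma C_k_sum: "(\<And>i. i \<in> A \<Longrightarrow> C_k k (f i)) \<Longrightarrow> C_k k (\<lambda>x. \<Sum>i\<in>A. f i x)"
  by (induction A rule: infinite_finite_induct) (auto intro: C_k_const C_k_add)

text \<open>The witness is a whole sequence of successive derivatives; iterated derivatives need not
  be computed from \<open>h\<close>, and \<open>flat\<close> supplies such a sequence by its
  polynomial recursion.\<close>

definition smooth :: "(real \<Rightarrow> real) \<Rightarrow> bool" where
  "smooth h \<longleftrightarrow> (\<exists>D. D 0 = h \<and> (\<forall>i x. (D i has_real_derivative D (Suc i) x) (at x)))"

lemma frechet_derivative_real_comp:
  fixes f :: "'a::real_normed_vector \<Rightarrow> real"
  assumes "(h has_real_derivative d) (at (f x))" "f differentiable (at x)"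
  shows "(\<lambda>x. h (f x)) differentiable (at x)"
    and "frechet_derivative (\<lambda>x. h (f x)) (at x) b = d * frechet_derivative f (at x) b"
proof -
  have *: "((\<lambda>x. h (f x)) has_derivative (\<lambda>y. frechet_derivative f (at x) y * d)) (at x)"
    using assms by (intro DERIV_compose_FDERIV) (auto simp: frechet_derivative_works)
  then show "(\<lambda>x. h (f x)) differentiable (at x)" by (rule differentiableI)
  from fun_cong[OF frechet_derivative_at[OF *], of b]
  show "frechet_derivative (\<lambda>x. h (f x)) (at x) b = d * frechet_derivative f (at x) b"
    by (simp add: mult.commute)
qed

lemma C_k_comp:
  assumes "smooth h" "C_k k f"
  shows "C_k k (\<lambda>x. h (f x))"
proof -
  obtain D where D: "D 0 = h" "\<And>i x. (D i has_real_derivative D (Suc i) x) (at x)"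
    using assms(1) by (auto simp: smooth_def)
  \<comment> \<open>Stated for every \<open>i\<close>, since differentiating
    \<open>D i (f x)\<close> produces \<open>D (Suc i) (f x)\<close>.\<close>
  have "C_k k (\<lambda>x. D i (f x))" for i
    using assms(2)
  proof (induction k arbitrary: i)
    case 0
    have "continuous_on UNIV (D i)"
      by (intro continuous_at_imp_continuous_on ballI DERIV_isCont[OF D(2)])
    with 0 show ?case by (auto intro: continuous_on_compose2)
  next
    case (Suc k)
    have "C_k k (\<lambda>x. D (Suc i) (f x) * frechet_derivative f (at x) b)" if "b \<in> Basis" for b
      using Suc.prems that by (intro C_k_mult Suc.IH C_k_Suc_imp[OF Suc.prems]) auto
    with Suc.prems show ?case
      by (auto simp: frechet_derivative_real_comp[OF D(2)])
  qed
  from this[of 0] D show ?thesis by simp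
qed

lemma frechet_derivative_cong_open:
  assumes "open S" "x \<in> S" "\<And>y. y \<in> S \<Longrightarrow> f y = g y" "g differentiable (at x)"
  shows "f differentiable (at x)" "frechet_derivative f (at x) = frechet_derivative g (at x)"
proof -
  have "(g has_derivative frechet_derivative g (at x)) (at x)"
    using assms(4) frechet_derivative_works by blast
  then have *: "(f has_derivative frechet_derivative g (at x)) (at x)"
    by (rule has_derivative_transform_within_open[OF _ assms(1,2)]) (simp add: assms(3))
  show "f differentiable (at x)" by (rule differentiableI[OF *])
  show "frechet_derivative f (at x) = frechet_derivative g (at x)"
    by (rule frechet_derivative_at[OF *, symmetric])
qed

lemma frechet_derivative_eq_0_outside:
  fixes f :: "'a::euclidean_space \<Rightarrow> 'b::real_normed_vector"
  assumes "compact K" "\<And>x. x \<notin> K \<Longrightarrow> f x = 0" "x \<notin> K"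
  shows "frechet_derivative f (at x) = (\<lambda>_. 0)"
proof -
  have "open (- K)" using assms(1) by (simp add: compact_imp_closed open_Compl)
  from frechet_derivative_cong_open(2)[OF this, of x f "\<lambda>_. 0"] show ?thesis
    using assms by simp
qed

text \<open>On each open piece the derivative of \<open>p\<close> is that of \<open>f\<close> or of
  \<open>g\<close>, so the partial derivatives satisfy the same hypotheses one level lower. This
  makes functions smooth that are given by a formula on the domain and by 0 elsewhere.\<close>

lemma C_k_glue:
  assumes "open A" "open B" "A \<union> B = UNIV"
  shows "C_k k f \<Longrightarrow> C_k k g \<Longrightarrow> (\<And>x. x \<in> A \<Longrightarrow> p x = f x) \<Longrightarrow> (\<And>x. x \<in> B \<Longrightarrow> p x = g x)
    \<Longrightarrow> C_k k p"
proof (induction k arbitrary: f g p)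
  case 0
  have "continuous_on A p" "continuous_on B p"
    using 0 continuous_on_subset[of UNIV f A] continuous_on_subset[of UNIV g B]
    by (simp_all cong: continuous_on_cong)
  then have "continuous_on (A \<union> B) p" using assms by (intro continuous_on_open_Un)
  then show ?case using assms by simp
next
  case (Suc k)
  have d: "f differentiable (at x)" "g differentiable (at x)" for x using Suc.prems by auto
  note A = frechet_derivative_cong_open[OF assms(1) _ Suc.prems(3) d(1)]
  note B = frechet_derivative_cong_open[OF assms(2) _ Suc.prems(4) d(2)]
  have "p differentiable (at x)" for x
    using A(1) B(1) assms(3) by blast
  moreover have "C_k k (\<lambda>x. frechet_derivative p (at x) b)" if "b \<in> Basis" for b
  proof (rule Suc.IH)
    show "C_k k (\<lambda>x. frechet_derivative f (at x) b)" "C_k k (\<lambda>x. frechet_derivative g (at x) b)"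
      using Suc.prems that by simp_all
  qed (simp_all add: A(2) B(2))
  ultimately show ?case by simp
qed

text \<open>Closed under differentiation, and containing \<open>exp (-1/t)\<close> for \<open>t > 0\<close>.\<close>

definition flat :: "real poly \<Rightarrow> real \<Rightarrow> real" where
  "flat p t = (if t > 0 then poly p (1 / t) * exp (- (1 / t)) else 0)"

lemma poly_exp_minus_tendsto_0: "((\<lambda>s. poly p s * exp (- s)) \<longlongrightarrow> (0::real)) at_top"
proof -
  have "((\<lambda>s. \<Sum>i\<le>degree p. coeff p i * (s ^ i / exp s)) \<longlongrightarrow> (\<Sum>i\<le>degree p. coeff p i * 0)) at_top"
    by (intro tendsto_intros tendsto_power_div_exp_0)
  then show ?thesis
    by (simp add: poly_altdef sum_distrib_right exp_minus divide_inverse mult.assoc)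
qed

text \<open>For \<open>t > 0\<close> the inner derivative contributes \<open>1 / t^2\<close>, the
  value of the polynomial \<open>[:0, 0, 1:]\<close> at \<open>1 / t\<close>, so the form
  \<open>flat\<close> is preserved. At 0 the exponential beats every polynomial in
  \<open>1 / t\<close>.\<close>

lemma flat_has_derivative:
  "(flat p has_real_derivative flat ([:0, 0, 1:] * (p - pderiv p)) t) (at t)"
proof -
  consider "t > 0" | "t < 0" | "t = 0" by linarith
  then show ?thesis
  proof cases
    case 1
    have i: "((\<lambda>t. 1 / t) has_real_derivative (- (1 / t\<^sup>2))) (at t)"
      using 1 by (auto intro!: derivative_eq_intros simp: power2_eq_square)
    have "((\<lambda>t. poly p (1 / t) * exp (- (1 / t))) has_real_derivative
        (poly (pderiv p) (1 / t) * (- (1 / t\<^sup>2))) * exp (- (1 / t))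
          + (exp (- (1 / t)) * - (- (1 / t\<^sup>2))) * poly p (1 / t)) (at t)"
      by (intro DERIV_mult DERIV_chain2[OF poly_DERIV i] DERIV_chain2[OF DERIV_exp] DERIV_minus i)
    also have "(poly (pderiv p) (1 / t) * (- (1 / t\<^sup>2))) * exp (- (1 / t))
          + (exp (- (1 / t)) * - (- (1 / t\<^sup>2))) * poly p (1 / t)
        = flat ([:0, 0, 1:] * (p - pderiv p)) t"
      using 1 by (simp add: flat_def power2_eq_square algebra_simps)
    finally show ?thesis
      by (rule has_field_derivative_transform_within_open[of _ _ _ "{0<..}"])
         (use 1 in \<open>auto simp: flat_def\<close>)
  next
    case 2
    have "((\<lambda>t. 0) has_real_derivative flat ([:0, 0, 1:] * (p - pderiv p)) t) (at t)"
      using 2 by (auto simp: flat_def)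
    then show ?thesis
      by (rule has_field_derivative_transform_within_open[of _ _ _ "{..<0}"])
         (use 2 in \<open>auto simp: flat_def\<close>)
  next
    case 3
    \<comment> \<open>Dividing by \<open>t\<close> multiplies the polynomial in \<open>1 / t\<close>
      by its variable; the substitution \<open>s = 1 / t\<close> moves the limit to
      infinity.\<close>
    have "((\<lambda>s. poly ([:0, 1:] * p) s * exp (- s)) \<longlongrightarrow> 0) at_top"
      by (rule poly_exp_minus_tendsto_0)
    then have "((\<lambda>t. poly ([:0, 1:] * p) (1 / t) * exp (- (1 / t))) \<longlongrightarrow> 0) (at_right 0)"
      unfolding filterlim_at_right_to_top by (simp add: inverse_eq_divide)
    then have r: "((\<lambda>t. flat p t / t) \<longlongrightarrow> 0) (at_right 0)"
      by (rule filterlim_mono_eventually[OF _ order_refl order_refl])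
         (auto simp: eventually_at_filter flat_def)
    have l: "((\<lambda>t. flat p t / t) \<longlongrightarrow> 0) (at_left 0)"
      by (rule tendsto_eventually) (auto simp: eventually_at_filter flat_def)
    have "((\<lambda>t. flat p t / t) \<longlongrightarrow> 0) (at 0)"
      using l r filterlim_split_at by blast
    then show ?thesis using 3
      by (simp add: has_field_derivative_iff flat_def)
  qed
qed

lemma smooth_flat: "smooth (flat p)"
  unfolding smooth_def
  by (rule exI[of _ "\<lambda>i. flat (((\<lambda>p. [:0, 0, 1:] * (p - pderiv p)) ^^ i) p)"])
     (use flat_has_derivative in auto)

lemma smooth_antiderivative:
  assumes "smooth g" "\<And>x. (f has_real_derivative g x) (at x)"
  shows "smooth f"
proof -
  obtain D where D: "D 0 = g" "\<And>i x. (D i has_real_derivative D (Suc i) x) (at x)"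
    using assms(1) by (auto simp: smooth_def)
  have "((case_nat f D i) has_real_derivative case_nat f D (Suc i) x) (at x)" for i x
    using D assms(2) by (cases i) auto
  then show ?thesis unfolding smooth_def by (intro exI[of _ "case_nat f D"]) auto
qed

section \<open>The cutoff function used in the comparison and its bounds\<close>

abbreviation bump :: "real \<Rightarrow> real" where "bump \<equiv> flat 1"
abbreviation bump' :: "real \<Rightarrow> real" where "bump' \<equiv> flat [:0, 0, 1:]"

lemma bump_has_derivative: "(bump has_real_derivative bump' t) (at t)"
  using flat_has_derivative[of 1 t] by simp

lemma bump_nonneg: "bump t \<ge> 0" and bump_pos_iff: "bump t > 0 \<longleftrightarrow> t > 0"
  and bump_nonpos: "t \<le> 0 \<Longrightarrow> bump t = 0" and bump_le_1: "bump t \<le> 1"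
  by (auto simp: flat_def)

lemma flat_nonneg: "(\<And>s. s > 0 \<Longrightarrow> poly p s \<ge> 0) \<Longrightarrow> flat p t \<ge> 0"
  by (simp add: flat_def)

lemma bump'_nonneg: "bump' t \<ge> 0"
  by (intro flat_nonneg) simp

text \<open>With \<open>s = 1 / t\<close> this is \<open>s^2 * exp (- s) \<le> 2\<close>, read off
  from the quadratic Taylor bound for \<open>exp\<close>. The 2 becomes the Lipschitz constant of
  \<open>bump\<close> and enters the energy estimate.\<close>

lemma bump'_le: "bump' t \<le> 2"
proof (cases "t > 0")
  case True
  define s where "s = 1 / t"
  have s: "s > 0" using True by (simp add: s_def)
  have "s\<^sup>2 / 2 \<le> exp s"
    using exp_lower_Taylor_quadratic[of s] s by linarith
  then have "s * s * exp (- s) \<le> 2"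
    by (simp add: exp_minus field_simps power2_eq_square)
  then show ?thesis using True by (simp add: flat_def s_def)
qed (auto simp: flat_def)

lemma bump_lipschitz: "bump a \<le> bump b + 2 * \<bar>a - b\<bar>"
proof -
  have "\<bar>bump a - bump b\<bar> \<le> 2 * \<bar>a - b\<bar>"
    using field_differentiable_bound[of UNIV bump bump' 2 a b]
      bump_has_derivative bump'_nonneg bump'_le
    by (auto simp: has_field_derivative_at_within)
  then show ?thesis by linarith
qed

subsection \<open>Integration by parts\<close>

lemma integrable_lborel_continuous_compact_support:
  fixes f :: "'a::euclidean_space \<Rightarrow> real"
  assumes "continuous_on UNIV f" "compact K" "\<And>x. x \<notin> K \<Longrightarrow> f x = 0"
  shows "integrable lborel f"
proof -
  have "integrable lborel (\<lambda>x. indicator K x *\<^sub>R f x)"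
    by (rule borel_integrable_compact[OF assms(2)]) (rule continuous_on_subset[OF assms(1)], simp)
  moreover have "(\<lambda>x. indicator K x *\<^sub>R f x) = f"
    using assms(3) by (auto simp: fun_eq_iff indicator_def)
  ultimately show ?thesis by simp
qed

lemma bounded_continuous_compact_support:
  fixes f :: "'a::euclidean_space \<Rightarrow> real"
  assumes "continuous_on UNIV f" "compact K" "\<And>x. x \<notin> K \<Longrightarrow> f x = 0"
  obtains B where "B \<ge> 0" "\<And>x. \<bar>f x\<bar> \<le> B"
proof -
  have "compact (f ` K)"
    by (rule compact_continuous_image[OF continuous_on_subset[OF assms(1)] assms(2)]) simp
  then obtain B where B: "\<forall>x\<in>f ` K. norm x \<le> B" using compact_imp_bounded bounded_iff by metis
  have "\<bar>f x\<bar> \<le> max B 0" for x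
    using B assms(3)[of x] by (cases "x \<in> K") auto
  then show thesis by (intro that[of "max B 0"]) auto
qed

lemma has_real_derivative_along_line:
  fixes f :: "'a::real_normed_vector \<Rightarrow> real"
  assumes "f differentiable (at (x + t *\<^sub>R b))"
  shows "((\<lambda>t. f (x + t *\<^sub>R b)) has_real_derivative frechet_derivative f (at (x + t *\<^sub>R b)) b) (at t)"
proof -
  have "(f has_derivative frechet_derivative f (at (x + t *\<^sub>R b))) (at (x + t *\<^sub>R b))"
    using assms frechet_derivative_works by blast
  then have "((\<lambda>t. f (x + t *\<^sub>R b)) has_derivative
      (\<lambda>h. frechet_derivative f (at (x + t *\<^sub>R b)) (h *\<^sub>R b))) (at t)"
    by (rule has_derivative_compose[rotated]) (auto intro!: derivative_eq_intros)
  moreover have "(\<lambda>h. frechet_derivative f (at (x + t *\<^sub>R b)) (h *\<^sub>R b))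
      = (*) (frechet_derivative f (at (x + t *\<^sub>R b)) b)"
    using linear_frechet_derivative[OF assms] by (simp add: fun_eq_iff linear_cmul mult.commute)
  ultimately show ?thesis by (simp add: has_field_derivative_def)
qed

text \<open>Translation invariance makes every difference quotient integrate to zero.\<close>

lemma integral_partial_derivative_eq_0:
  fixes f :: "'a::euclidean_space \<Rightarrow> real"
  assumes f: "\<And>x. f differentiable (at x)"
    and c: "continuous_on UNIV (\<lambda>x. frechet_derivative f (at x) b)"
    and K: "compact K" "\<And>x. x \<notin> K \<Longrightarrow> f x = 0"
  shows "(LINT x|lborel. frechet_derivative f (at x) b) = 0"
proof -
  have cf: "continuous_on UNIV f"
    by (intro continuous_at_imp_continuous_on ballI differentiable_imp_continuous_within f)
  have d0: "frechet_derivative f (at x) b = 0" if "x \<notin> K" for x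
    by (simp add: frechet_derivative_eq_0_outside[OF K that])
  obtain B where B: "B \<ge> 0" "\<And>x. \<bar>frechet_derivative f (at x) b\<bar> \<le> B"
    using bounded_continuous_compact_support[OF c K(1) d0] by blast
  obtain R where R: "\<And>x. x \<in> K \<Longrightarrow> norm x \<le> R"
    using compact_imp_bounded[OF K(1)] bounded_iff by metis
  define q where "q n x = real (Suc n) * (f (x + (1 / real (Suc n)) *\<^sub>R b) - f x)" for n x
  have m[measurable]: "f \<in> borel_measurable borel" "(\<lambda>x. frechet_derivative f (at x) b) \<in> borel_measurable borel"
    using borel_measurable_continuous_onI[OF cf] borel_measurable_continuous_onI[OF c] by simp_all
  have int_f: "integrable lborel f" by (rule integrable_lborel_continuous_compact_support[OF cf K])
  have shift: "integrable lborel (\<lambda>x. f (x + a))" "(LINT x|lborel. f (x + a)) = (LINT x|lborel. f x)" for a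
  proof -
    have "integrable (distr lborel borel ((+) a)) f" using int_f by (simp add: lborel_distr_plus)
    then show "integrable lborel (\<lambda>x. f (x + a))"
      by (subst (asm) integrable_distr_eq) (auto simp: add.commute)
    have "(LINT x|lborel. f x) = (LINT x|distr lborel borel ((+) a). f x)"
      by (simp add: lborel_distr_plus)
    also have "\<dots> = (LINT x|lborel. f (a + x))"
      using int_f by (intro integral_distr) auto
    finally show "(LINT x|lborel. f (x + a)) = (LINT x|lborel. f x)" by (simp add: add.commute)
  qed
  have int_q: "(LINT x|lborel. q n x) = 0" for n
    unfolding q_def using shift int_f by simp
  have lim: "(\<lambda>n. q n x) \<longlonglongrightarrow> frechet_derivative f (at x) b" for x
  proof -
    have "((\<lambda>t. f (x + t *\<^sub>R b)) has_real_derivative frechet_derivative f (at x) b) (at 0)"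
      using has_real_derivative_along_line[of f x 0 b] f by simp
    then have "((\<lambda>t. (f (x + t *\<^sub>R b) - f x) / t) \<longlongrightarrow> frechet_derivative f (at x) b) (at 0)"
      by (simp add: has_field_derivative_iff)
    moreover have "filterlim (\<lambda>n. 1 / real (Suc n)) (at 0) sequentially"
      using LIMSEQ_inverse_real_of_nat
      by (auto simp: filterlim_at inverse_eq_divide)
    ultimately have "(\<lambda>n. (f (x + (1 / real (Suc n)) *\<^sub>R b) - f x) / (1 / real (Suc n)))
        \<longlonglongrightarrow> frechet_derivative f (at x) b"
      by (rule filterlim_compose)
    then show ?thesis by (simp add: q_def mult.commute)
  qed
  \<comment> \<open>Domination: the mean value theorem bounds the quotient by \<open>B\<close>, and
    as the step is at most 1, both points avoid \<open>K\<close> once \<open>x\<close> is outside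
    the ball enlarged by \<open>norm b\<close>.\<close>
  have bd: "norm (q n x) \<le> B * indicator (cball 0 (R + norm b)) x" for n x
  proof (cases "x \<in> cball 0 (R + norm b)")
    case True
    have "norm (f (x + (1 / real (Suc n)) *\<^sub>R b) - f (x + 0 *\<^sub>R b)) \<le> B * norm (1 / real (Suc n) - 0)"
      by (rule field_differentiable_bound[of UNIV _ "\<lambda>t. frechet_derivative f (at (x + t *\<^sub>R b)) b"])
        (use has_real_derivative_along_line[OF f] B(2) in auto)
    then have "real (Suc n) * \<bar>f (x + (1 / real (Suc n)) *\<^sub>R b) - f x\<bar> \<le> B"
      by (simp add: field_simps)
    then show ?thesis using True by (simp add: q_def abs_mult)
  next
    case False
    have n: "norm ((1 / real (Suc n)) *\<^sub>R b) \<le> norm b"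
      using mult_right_mono[of "1 / real (Suc n)" 1 "norm b"] by simp
    have "x \<notin> K" using False R[of x] norm_ge_zero[of b] by (auto simp del: norm_ge_zero)
    moreover have "x + (1 / real (Suc n)) *\<^sub>R b \<notin> K"
      using False R[of "x + (1 / real (Suc n)) *\<^sub>R b"] n
        norm_triangle_ineq4[of "x + (1 / real (Suc n)) *\<^sub>R b" "(1 / real (Suc n)) *\<^sub>R b"] by auto
    ultimately show ?thesis using False K(2) by (simp add: q_def)
  qed
  have "(\<lambda>n. LINT x|lborel. q n x) \<longlonglongrightarrow> (LINT x|lborel. frechet_derivative f (at x) b)"
  proof (rule integral_dominated_convergence)
    show "integrable lborel (\<lambda>x. B * indicator (cball 0 (R + norm b)) x)"
      by (intro integrable_mult_right integrable_real_indicator)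
        (use emeasure_lborel_cball_finite in auto)
  qed (use lim bd m in \<open>auto simp: q_def\<close>)
  then show ?thesis by (simp add: int_q LIMSEQ_const_iff)
qed

section \<open>Green's identity with one compactly supported factor\<close>

definition laplacian :: "('a::euclidean_space \<Rightarrow> real) \<Rightarrow> 'a \<Rightarrow> real" where
  "laplacian v x = (\<Sum>b\<in>Basis. frechet_derivative (\<lambda>y. frechet_derivative v (at y) b) (at x) b)"

lemma C_k_SucD:
  assumes "C_k (Suc k) f"
  shows "f differentiable (at x)"
    and "b \<in> Basis \<Longrightarrow> C_k k (\<lambda>x. frechet_derivative f (at x) b)"
  using assms by auto

lemma grad_inner_Basis: "b \<in> Basis \<Longrightarrow> grad f x \<bullet> b = frechet_derivative f (at x) b"
  by (simp add: grad_def)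

lemma inner_grad: "grad f x \<bullet> grad g x
    = (\<Sum>b\<in>Basis. frechet_derivative f (at x) b * frechet_derivative g (at x) b)"
  by (subst euclidean_inner) (simp add: grad_inner_Basis)

lemma continuous_on_grad: "C_k (Suc 0) f \<Longrightarrow> continuous_on UNIV (grad f)"
  unfolding grad_def[abs_def] by (intro continuous_intros) auto

lemma continuous_on_laplacian:
  assumes "C_k 2 v"
  shows "continuous_on UNIV (laplacian v)"
  using assms unfolding laplacian_def[abs_def]
  by (intro continuous_intros) (simp_all add: numeral_2_eq_2)

text \<open>The divergence of \<open>p\<close> times the gradient of \<open>v\<close> is the sum of
  the two integrands. Each of its terms is a partial derivative of a compactly supported function
  and integrates to 0.\<close>

lemma integral_grad_inner_grad:
  fixes v p :: "'a::euclidean_space \<Rightarrow> real"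
  assumes v: "C_k 2 v" and p: "C_k 1 p" and K: "compact K" "\<And>x. x \<notin> K \<Longrightarrow> p x = 0"
  shows "(LINT x|lborel. grad v x \<bullet> grad p x) = - (LINT x|lborel. laplacian v x * p x)"
proof -
  have v': "C_k (Suc 0) (\<lambda>x. frechet_derivative v (at x) b)" if "b \<in> Basis" for b
    using v that by (simp add: numeral_2_eq_2)
  have p': "C_k (Suc 0) p" using p by simp
  define F where "F b x = p x * frechet_derivative v (at x) b" for b x
  have F: "C_k (Suc 0) (F b)" if "b \<in> Basis" for b
    unfolding F_def using C_k_mult[OF p' v'[OF that]] .
  have DF: "frechet_derivative (F b) (at x) b = frechet_derivative v (at x) b * frechet_derivative p (at x) b
      + frechet_derivative (\<lambda>y. frechet_derivative v (at y) b) (at x) b * p x" if "b \<in> Basis" for b x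
    unfolding F_def
    using frechet_derivative_mult[OF C_k_SucD(1)[OF p'] C_k_SucD(1)[OF v'[OF that]]]
    by (simp add: mult.commute add.commute)
  have int: "integrable lborel (\<lambda>x. frechet_derivative (F b) (at x) b)" if b: "b \<in> Basis" for b
  proof (rule integrable_lborel_continuous_compact_support)
    show "continuous_on UNIV (\<lambda>x. frechet_derivative (F b) (at x) b)"
      using C_k_SucD(2)[OF F[OF b] b] by simp
    show "frechet_derivative (F b) (at x) b = 0" if "x \<notin> K" for x
      using frechet_derivative_eq_0_outside[OF K(1), of "F b" x] that K(2) by (simp add: F_def)
  qed (rule K(1))
  have "(LINT x|lborel. grad v x \<bullet> grad p x + laplacian v x * p x)
      = (LINT x|lborel. (\<Sum>b\<in>Basis. frechet_derivative (F b) (at x) b))"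
    by (intro Bochner_Integration.integral_cong refl)
      (simp add: DF inner_grad laplacian_def sum.distrib sum_distrib_right)
  also have "\<dots> = (\<Sum>b\<in>Basis. LINT x|lborel. frechet_derivative (F b) (at x) b)"
    by (rule Bochner_Integration.integral_sum) (rule int)
  also have "\<dots> = 0"
  proof (rule sum.neutral, rule ballI)
    fix b :: 'a assume b: "b \<in> Basis"
    show "(LINT x|lborel. frechet_derivative (F b) (at x) b) = 0"
      by (rule integral_partial_derivative_eq_0[OF C_k_SucD(1)[OF F[OF b]] _ K(1)])
        (use C_k_SucD(2)[OF F[OF b] b] K(2) in \<open>simp_all add: F_def\<close>)
  qed
  finally have s: "(LINT x|lborel. grad v x \<bullet> grad p x + laplacian v x * p x) = 0" .
  have i1: "integrable lborel (\<lambda>x. laplacian v x * p x)"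
    by (rule integrable_lborel_continuous_compact_support[OF _ K(1)])
      (use continuous_on_laplacian[OF v] C_k_imp_continuous_on[OF p] K(2) in \<open>auto intro!: continuous_intros\<close>)
  have z: "grad p x = 0" if "x \<notin> K" for x
    by (simp add: grad_def frechet_derivative_eq_0_outside[OF K that])
  have cv: "C_k (Suc 0) v" using v C_k_Suc_imp by (metis numeral_2_eq_2)
  have i2: "integrable lborel (\<lambda>x. grad v x \<bullet> grad p x)"
    by (rule integrable_lborel_continuous_compact_support[OF _ K(1)])
      (use continuous_on_grad[OF cv] continuous_on_grad[OF p'] z in \<open>auto intro!: continuous_intros\<close>)
  show ?thesis using s i1 i2 by simp
qed

subsection \<open>A comparison principle for weak solutions\<close>

lemma set_lebesgue_integral_eq_lebesgue_on:
  "open \<Omega> \<Longrightarrow> (LINT x:\<Omega>|lebesgue. f x) = integral\<^sup>L (lebesgue_on \<Omega>) f"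
  for f :: "'a::euclidean_space \<Rightarrow> real"
  by (simp add: set_lebesgue_integral_def integral_restrict_space)

lemma L2_onD:
  assumes "f \<in> L2_on \<Omega>" "open \<Omega>"
  shows "f \<in> borel_measurable (lebesgue_on \<Omega>)" "integrable (lebesgue_on \<Omega>) (\<lambda>x. (norm (f x))\<^sup>2)"
  using assms by (auto simp: L2_on_def set_borel_measurable_def set_integrable_def
      borel_measurable_restrict_space_iff integrable_restrict_space)

lemma finite_measure_lebesgue_on_open: "open \<Omega> \<Longrightarrow> bounded \<Omega> \<Longrightarrow> finite_measure (lebesgue_on \<Omega>)"
  for \<Omega> :: "'a::euclidean_space set"
  by (intro finite_measure_lebesgue_on lmeasurable_open)

lemma integrable_lebesgue_on_continuous:
  fixes f :: "'a::euclidean_space \<Rightarrow> 'b::euclidean_space"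
  assumes "open \<Omega>" "bounded \<Omega>" "continuous_on UNIV f"
  shows "integrable (lebesgue_on \<Omega>) f"
proof -
  have "compact (f ` closure \<Omega>)"
    using assms by (intro compact_continuous_image continuous_on_subset[OF assms(3)]) auto
  then obtain B where B: "\<And>x. x \<in> closure \<Omega> \<Longrightarrow> norm (f x) \<le> B"
    using compact_imp_bounded[OF \<open>compact (f ` closure \<Omega>)\<close>] by (auto simp: bounded_iff)
  have "AE x in lebesgue_on \<Omega>. norm (f x) \<le> B"
    by (intro AE_I2) (use B closure_subset in \<open>auto simp: space_restrict_space\<close>)
  moreover have "f \<in> borel_measurable (lebesgue_on \<Omega>)"
    using assms by (intro continuous_imp_measurable_on_sets_lebesgue continuous_on_subset[OF assms(3)]) auto
  ultimately show ?thesis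
    using finite_measure.integrable_const_bound finite_measure_lebesgue_on_open assms by blast
qed

text \<open>The sign \<open>s\<close> treats sub- and supersolutions at once. The margin \<open>\<delta>\<close> by which \<open>v\<close> is strict
  replaces the Poincare inequality. With \<open>d = \<nabla>(v - \<phi>)\<close> and \<open>e = \<nabla>\<phi> - g\<close>, the gradient term is
  \<open>H' (d + e) \<bullet> d\<close>, and \<open>(d + e) \<bullet> d \<ge> - \<bar>e\<bar>\<^sup>2/4\<close>.\<close>

lemma comparison_step:
  fixes \<Omega> :: "'a::euclidean_space set"
  assumes \<Omega>: "open \<Omega>" "bounded \<Omega>"
    and u: "has_weak_gradient_L2 \<Omega> u g" "weak_laplacian \<Omega> u (\<lambda>_. -1)"
    and v: "\<And>k. C_k k v" and K: "compact K" "K \<subseteq> \<Omega>" and s: "s = 1 \<or> s = -1"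
    and sign: "\<And>x. x \<in> \<Omega> - K \<Longrightarrow> s * v x \<le> 0"
    and lap: "\<And>x. x \<in> \<Omega> \<Longrightarrow> \<delta> \<le> s * (laplacian v x + 1)"
    and \<phi>: "\<phi> \<in> test_functions \<Omega>"
  shows "\<delta> * (LINT x:\<Omega>|lebesgue. bump (s * (v x - \<phi> x)))
      \<le> (LINT x:\<Omega>|lebesgue. (norm (grad \<phi> x - g x))\<^sup>2) / 2"
proof -
  define M where "M = lebesgue_on \<Omega>"
  interpret finite_measure M unfolding M_def by (rule finite_measure_lebesgue_on_open[OF \<Omega>])
  have space_M: "space M = \<Omega>" by (simp add: M_def space_restrict_space)
  note LM = set_lebesgue_integral_eq_lebesgue_on[OF \<Omega>(1), folded M_def]
  note cint = integrable_lebesgue_on_continuous[OF \<Omega>, folded M_def]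
  define w where "w x = s * (v x - \<phi> x)" for x
  define \<psi> where "\<psi> x = (if x \<in> \<Omega> then bump (w x) else 0)" for x
  \<comment> \<open>On \<open>\<Omega>\<close> outside \<open>L\<close> one has
    \<open>\<phi> = 0\<close> and \<open>s * v \<le> 0\<close>, so \<open>bump\<close> sends
    \<open>w\<close> to 0: this confines the support of \<open>\<psi>\<close> to a compact subset of
    \<open>\<Omega>\<close>.\<close>
  define L where "L = K \<union> closure {x. \<phi> x \<noteq> 0}"
  have \<phi>_smooth: "C_k k \<phi>" for k using \<phi> by (simp add: test_functions_def)
  have L: "compact L" "L \<subseteq> \<Omega>" using \<phi> K by (auto simp: L_def test_functions_def)
  have ss: "s * s = 1" using s by auto
  have w_alt: "w = (\<lambda>x. s * (v x + (-1) * \<phi> x))" by (simp add: fun_eq_iff w_def)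
  have w_smooth: "C_k k w" for k
    unfolding w_alt by (intro C_k_mult C_k_add C_k_const v \<phi>_smooth)
  have out: "bump (w x) = 0" if "x \<in> \<Omega>" "x \<notin> L" for x
  proof -
    have "\<phi> x = 0" "x \<notin> K" using that closure_subset[of "{x. \<phi> x \<noteq> 0}"] by (auto simp: L_def)
    then show ?thesis using sign[of x] that by (intro bump_nonpos) (auto simp: w_def)
  qed
  have \<psi>_out: "\<psi> x = 0" if "x \<notin> L" for x using out that by (simp add: \<psi>_def)
  have bw_smooth: "C_k k (\<lambda>x. bump (w x))" for k
    by (rule C_k_comp[OF smooth_flat w_smooth])
  have oL: "open (- L)" using L(1) by (simp add: compact_imp_closed open_Compl)
  have \<psi>_smooth: "C_k k \<psi>" for k
    by (rule C_k_glue[of \<Omega> "- L", OF \<Omega>(1) oL _ bw_smooth C_k_const[of _ 0]])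
      (use L(2) \<psi>_out in \<open>auto simp: \<psi>_def\<close>)
  have "closure {x. \<psi> x \<noteq> 0} \<subseteq> L"
    using \<psi>_out by (intro closure_minimal compact_imp_closed[OF L(1)]) auto
  then have \<psi>: "\<psi> \<in> test_functions \<Omega>"
    using \<psi>_smooth L closed_Int_compact[OF closed_closure[of "{x. \<psi> x \<noteq> 0}"] L(1)]
    by (simp add: test_functions_def Int_absorb2 subset_trans)
  have dv: "v differentiable (at x)" "\<phi> differentiable (at x)" "w differentiable (at x)" for x
    using v[of 1] \<phi>_smooth[of 1] w_smooth[of 1] by simp_all
  have dw: "frechet_derivative w (at x) b
      = s * (frechet_derivative v (at x) b - frechet_derivative \<phi> (at x) b)" for x b
  proof -
    have "((\<lambda>x. s * (v x - \<phi> x)) has_derivative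
      (\<lambda>b. s * (frechet_derivative v (at x) b - frechet_derivative \<phi> (at x) b))) (at x)"
      using dv by (intro has_derivative_mult_right has_derivative_diff)
        (simp_all add: frechet_derivative_works[symmetric])
    from fun_cong[OF frechet_derivative_at[OF this], of b] show ?thesis
      by (simp add: w_def[abs_def])
  qed
  have d\<psi>: "grad \<psi> x = (bump' (w x) * s) *\<^sub>R (grad v x - grad \<phi> x)" if "x \<in> \<Omega>" for x
  proof -
    note c = frechet_derivative_real_comp[OF bump_has_derivative[of "w x"] dv(3)]
    have "frechet_derivative \<psi> (at x) = frechet_derivative (\<lambda>x. bump (w x)) (at x)"
      by (rule frechet_derivative_cong_open(2)[OF \<Omega>(1) that _ c(1)]) (simp add: \<psi>_def)
    then show ?thesis
      by (simp add: grad_def c(2) dw scaleR_sum_right sum_subtractf[symmetric] algebra_simps)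
  qed
  \<comment> \<open>Green's identity is stated on the whole space for \<open>lborel\<close>, the
    weak equation on \<open>\<Omega>\<close> for \<open>lebesgue\<close>; for functions living on
    \<open>L\<close> the two integrals agree.\<close>
  have lim: "(LINT x:\<Omega>|lebesgue. f x) = (LINT x|lborel. f x)"
    if "continuous_on UNIV f" "\<And>x. x \<notin> L \<Longrightarrow> f x = 0" for f :: "'a \<Rightarrow> real"
  proof -
    have "(\<lambda>x. indicator \<Omega> x *\<^sub>R f x) = f" using that(2) L(2) by (auto simp: fun_eq_iff indicator_def)
    moreover have "f \<in> borel_measurable lborel" using borel_measurable_continuous_onI[OF that(1)] by simp
    ultimately show ?thesis by (simp add: set_lebesgue_integral_def integral_completion)
  qed
  have grad_out: "grad \<psi> x = 0" if "x \<notin> L" for x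
    by (simp add: grad_def frechet_derivative_eq_0_outside[OF L(1) \<psi>_out that])
  have cg: "continuous_on UNIV (grad v)" "continuous_on UNIV (grad \<psi>)" "continuous_on UNIV (grad \<phi>)"
    "continuous_on UNIV \<psi>" "continuous_on UNIV (laplacian v)"
    by (rule continuous_on_grad[OF v] continuous_on_grad[OF \<psi>_smooth] continuous_on_grad[OF \<phi>_smooth]
        C_k_imp_continuous_on[OF \<psi>_smooth[of 0]] continuous_on_laplacian[OF v])+
  have 1: "(LINT x|M. grad v x \<bullet> grad \<psi> x) = - (LINT x|M. laplacian v x * \<psi> x)"
  proof -
    have "(LINT x:\<Omega>|lebesgue. grad v x \<bullet> grad \<psi> x) = (LINT x|lborel. grad v x \<bullet> grad \<psi> x)"
      by (rule lim) (use cg grad_out in \<open>auto intro!: continuous_intros\<close>)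
    also have "\<dots> = - (LINT x|lborel. laplacian v x * \<psi> x)"
      by (rule integral_grad_inner_grad[OF v \<psi>_smooth L(1) \<psi>_out])
    also have "(LINT x|lborel. laplacian v x * \<psi> x) = (LINT x:\<Omega>|lebesgue. laplacian v x * \<psi> x)"
      by (rule lim[symmetric]) (use cg \<psi>_out in \<open>auto intro!: continuous_intros\<close>)
    finally show ?thesis by (simp add: LM)
  qed
  have 2: "(LINT x|M. g x \<bullet> grad \<psi> x) = (LINT x|M. \<psi> x)"
  proof -
    have "(LINT x:\<Omega>|lebesgue. g x \<bullet> grad \<psi> x) = - (LINT x:\<Omega>|lebesgue. (-1) * \<psi> x)"
      using u \<psi> unfolding weak_laplacian_def by blast
    then show ?thesis by (simp add: LM)
  qed
  have gL2: "g \<in> L2_on \<Omega>" using u(1) by (simp add: has_weak_gradient_L2_def)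
  have [measurable]: "g \<in> borel_measurable M" using L2_onD(1)[OF gL2 \<Omega>(1)] by (simp add: M_def)
  have [measurable]: "grad \<psi> \<in> borel_measurable M" "grad \<phi> \<in> borel_measurable M"
    using cint[OF cg(2)] cint[OF cg(3)] by (auto dest: borel_measurable_integrable)
  have ig: "integrable M (\<lambda>x. (norm (g x))\<^sup>2)" using L2_onD(2)[OF gL2 \<Omega>(1)] by (simp add: M_def)
  have i2: "integrable M (\<lambda>x. (norm (grad \<psi> x))\<^sup>2)" "integrable M (\<lambda>x. (norm (grad \<phi> x))\<^sup>2)"
    by (rule cint; intro continuous_intros cg)+
  have ie: "integrable M (\<lambda>x. (norm (grad \<phi> x - g x))\<^sup>2)"
  proof (rule Bochner_Integration.integrable_bound)
    show "integrable M (\<lambda>x. 2 * (norm (grad \<phi> x))\<^sup>2 + 2 * (norm (g x))\<^sup>2)"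
      using ig i2 by simp
    have "(norm (grad \<phi> x - g x))\<^sup>2 \<le> 2 * (norm (grad \<phi> x))\<^sup>2 + 2 * (norm (g x))\<^sup>2" for x
      using inner_ge_zero[of "grad \<phi> x + g x"]
      by (simp add: power2_norm_eq_inner inner_simps inner_commute)
    then show "AE x in M. norm ((norm (grad \<phi> x - g x))\<^sup>2)
        \<le> norm (2 * (norm (grad \<phi> x))\<^sup>2 + 2 * (norm (g x))\<^sup>2)" by simp
  qed measurable
  have igp: "integrable M (\<lambda>x. g x \<bullet> grad \<psi> x)"
  proof (rule Bochner_Integration.integrable_bound)
    show "integrable M (\<lambda>x. (norm (g x))\<^sup>2 + (norm (grad \<psi> x))\<^sup>2)"
      using ig i2 by simp
    have "\<bar>g x \<bullet> grad \<psi> x\<bar> \<le> (norm (g x))\<^sup>2 + (norm (grad \<psi> x))\<^sup>2" for x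
      using Cauchy_Schwarz_ineq2[of "g x" "grad \<psi> x"]
        sum_squares_bound[of "norm (g x)" "norm (grad \<psi> x)"]
        mult_nonneg_nonneg[OF norm_ge_zero[of "g x"] norm_ge_zero[of "grad \<psi> x"]] by linarith
    then show "AE x in M. norm (g x \<bullet> grad \<psi> x) \<le> norm ((norm (g x))\<^sup>2 + (norm (grad \<psi> x))\<^sup>2)" by simp
  qed measurable
  have ivp: "integrable M (\<lambda>x. grad v x \<bullet> grad \<psi> x)" "integrable M \<psi>" "integrable M (\<lambda>x. laplacian v x * \<psi> x)"
    by (rule cint; intro continuous_intros cg)+
  have "- ((LINT x|M. (norm (grad \<phi> x - g x))\<^sup>2) / 2) = (LINT x|M. - ((norm (grad \<phi> x - g x))\<^sup>2) / 2)"
    by simp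
  also have "\<dots> \<le> (LINT x|M. s * (grad v x \<bullet> grad \<psi> x - g x \<bullet> grad \<psi> x))"
  proof (rule integral_mono)
    fix x assume "x \<in> space M"
    then have x: "x \<in> \<Omega>" by (simp add: space_M)
    define d e where "d = grad v x - grad \<phi> x" and "e = grad \<phi> x - g x"
    \<comment> \<open>One \<open>s\<close> is the factor in front, the other comes from the chain
      rule for \<open>w\<close>, so the sign cancels.\<close>
    have "s * (grad v x \<bullet> grad \<psi> x - g x \<bullet> grad \<psi> x) = s * s * bump' (w x) * ((d + e) \<bullet> d)"
      by (simp add: d\<psi>[OF x] d_def e_def inner_simps algebra_simps)
    also have "\<dots> = bump' (w x) * ((d + e) \<bullet> d)" by (simp add: ss)
    \<comment> \<open>Completing the square in \<open>2 *\<^sub>R d + e\<close>. The bound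
      \<open>bump' \<le> 2\<close> then turns the factor 1/4 into the 1/2 of the claim.\<close>
    also have "\<dots> \<ge> bump' (w x) * (- (e \<bullet> e) / 4)"
      using inner_ge_zero[of "2 *\<^sub>R d + e"]
      by (intro mult_left_mono bump'_nonneg) (simp add: inner_simps inner_commute)
    also have "bump' (w x) * (- (e \<bullet> e) / 4) \<ge> 2 * (- (e \<bullet> e) / 4)"
      by (rule mult_right_mono_neg[OF bump'_le]) simp
    finally show "- ((norm (grad \<phi> x - g x))\<^sup>2) / 2 \<le> s * (grad v x \<bullet> grad \<psi> x - g x \<bullet> grad \<psi> x)"
      by (simp add: e_def power2_norm_eq_inner)
  qed (use ie igp ivp in auto)
  \<comment> \<open>Green's identity for \<open>v\<close> and the weak equation for \<open>u\<close>
    replace the gradients by the defect of \<open>v\<close> in the equation.\<close>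
  also have "\<dots> = (LINT x|M. - (s * (laplacian v x + 1) * \<psi> x))"
    using igp ivp by (simp add: 1 2 algebra_simps)
  also have "\<dots> \<le> (LINT x|M. - (\<delta> * \<psi> x))"
  proof (rule integral_mono)
    fix x assume "x \<in> space M"
    then show "- (s * (laplacian v x + 1) * \<psi> x) \<le> - (\<delta> * \<psi> x)"
      using mult_right_mono[OF lap[of x], of "\<psi> x"] by (simp add: space_M \<psi>_def bump_nonneg)
  qed (use ivp in \<open>auto simp: algebra_simps\<close>)
  also have "(LINT x|M. - (\<delta> * \<psi> x)) = (LINT x|M. - (\<delta> * bump (w x)))"
    by (rule Bochner_Integration.integral_cong) (simp_all add: space_M \<psi>_def)
  also have "\<dots> = - \<delta> * (LINT x|M. bump (w x))"
    by simp
  finally show ?thesis by (simp add: LM w_def)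
qed

text \<open>Along the approximating test functions the energy bound tends to 0, so the integral of
  \<open>bump (s * (v x - u x))\<close> vanishes, and \<open>bump\<close> is positive exactly on the
  positive axis. The boundary values of \<open>u\<close> enter only through this
  approximation.\<close>

lemma comparison:
  fixes \<Omega> :: "'a::euclidean_space set"
  assumes \<Omega>: "open \<Omega>" "bounded \<Omega>"
    and u: "u \<in> W12_0 \<Omega>" "weak_laplacian \<Omega> u (\<lambda>_. -1)"
    and v: "\<And>k. C_k k v" and K: "compact K" "K \<subseteq> \<Omega>" and s: "s = 1 \<or> s = -1"
    and sign: "\<And>x. x \<in> \<Omega> - K \<Longrightarrow> s * v x \<le> 0"
    and \<delta>: "\<delta> > 0"
    and lap: "\<And>x. x \<in> \<Omega> \<Longrightarrow> \<delta> \<le> s * (laplacian v x + 1)"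
  shows "AE x in lebesgue. x \<in> \<Omega> \<longrightarrow> s * (v x - u x) \<le> 0"
proof -
  define M where "M = lebesgue_on \<Omega>"
  interpret finite_measure M unfolding M_def by (rule finite_measure_lebesgue_on_open[OF \<Omega>])
  have space_M: "space M = \<Omega>" by (simp add: M_def space_restrict_space)
  note LM = set_lebesgue_integral_eq_lebesgue_on[OF \<Omega>(1), folded M_def]
  note cint = integrable_lebesgue_on_continuous[OF \<Omega>, folded M_def]
  obtain g where g: "has_weak_gradient_L2 \<Omega> u g" using u(1) by (auto simp: W12_0_def W12_def)
  then obtain \<phi> where \<phi>: "\<And>n. \<phi> n \<in> test_functions \<Omega>"
    "(\<lambda>n. (LINT x:\<Omega>|lebesgue. (\<phi> n x - u x)\<^sup>2)
            + (LINT x:\<Omega>|lebesgue. (norm (grad (\<phi> n) x - g x))\<^sup>2)) \<longlonglongrightarrow> 0"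
    using u(1) unfolding W12_0_def by blast
  define B where "B n = (LINT x|M. (\<phi> n x - u x)\<^sup>2)" for n
  define A where "A n = (LINT x|M. (norm (grad (\<phi> n) x - g x))\<^sup>2)" for n
  have AB: "A n \<ge> 0" "B n \<ge> 0" for n by (simp_all add: A_def B_def)
  have lim: "(\<lambda>n. B n + A n) \<longlonglongrightarrow> 0" using \<phi>(2) by (simp add: LM A_def B_def)
  have B: "B \<longlonglongrightarrow> 0" and A: "A \<longlonglongrightarrow> 0"
    by (rule tendsto_sandwich[OF _ _ tendsto_const lim]; use AB in \<open>simp add: add_increasing add_increasing2\<close>)+
  have uL2: "u \<in> L2_on \<Omega>" using g by (simp add: has_weak_gradient_L2_def)
  have um[measurable]: "u \<in> borel_measurable M" using L2_onD(1)[OF uL2 \<Omega>(1)] by (simp add: M_def)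
  have ui: "integrable M (\<lambda>x. (u x)\<^sup>2)" using L2_onD(2)[OF uL2 \<Omega>(1)] by (simp add: M_def)
  have cv: "continuous_on UNIV v" using C_k_imp_continuous_on v by blast
  have cb: "continuous_on UNIV bump"
    by (intro continuous_at_imp_continuous_on ballI DERIV_isCont[OF bump_has_derivative])
  have bm[measurable]: "bump \<in> borel_measurable borel" using cb by (rule borel_measurable_continuous_onI)
  have vm[measurable]: "v \<in> borel_measurable M" using cint[OF cv] by (rule borel_measurable_integrable)
  define E where "E = (LINT x|M. bump (s * (v x - u x)))"
  have iE: "integrable M (\<lambda>x. bump (s * (v x - u x)))"
    by (rule integrable_const_bound[where B = 1]) (auto simp: bump_nonneg bump_le_1)
  \<comment> \<open>The Lipschitz bound for \<open>bump\<close> leaves the error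
    \<open>\<bar>\<phi> n x - u x\<bar>\<close>, but only its square is controlled; Young's
    inequality with parameter \<open>\<eta>\<close> trades one for the other. First \<open>n\<close>
    tends to infinity, then \<open>\<eta>\<close> to 0.\<close>
  have "E \<le> A n / (2 * \<delta>) + 2 * (\<eta> * measure M (space M) + B n / (4 * \<eta>))" if \<eta>: "\<eta> > 0" for \<eta> n
  proof -
    have c\<phi>: "continuous_on UNIV (\<phi> n)" using \<phi>(1)[of n] by (auto simp: test_functions_def intro: C_k_imp_continuous_on)
    have [measurable]: "\<phi> n \<in> borel_measurable M" using cint[OF c\<phi>] by (rule borel_measurable_integrable)
    have i1: "integrable M (\<lambda>x. bump (s * (v x - \<phi> n x)))"
      by (rule integrable_const_bound[where B = 1]) (auto simp: bump_nonneg bump_le_1)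
    have i2: "integrable M (\<lambda>x. (\<phi> n x - u x)\<^sup>2)"
    proof (rule Bochner_Integration.integrable_bound)
      show "integrable M (\<lambda>x. 2 * (\<phi> n x)\<^sup>2 + 2 * (u x)\<^sup>2)"
        by (intro Bochner_Integration.integrable_add integrable_mult_right ui cint continuous_intros c\<phi>)
      have "(\<phi> n x - u x)\<^sup>2 \<le> 2 * (\<phi> n x)\<^sup>2 + 2 * (u x)\<^sup>2" for x
        using zero_le_power2[of "\<phi> n x + u x"] by (simp add: power2_eq_square algebra_simps)
      then show "AE x in M. norm ((\<phi> n x - u x)\<^sup>2) \<le> norm (2 * (\<phi> n x)\<^sup>2 + 2 * (u x)\<^sup>2)" by simp
    qed measurable
    have "E \<le> (LINT x|M. bump (s * (v x - \<phi> n x)) + 2 * (\<eta> + (\<phi> n x - u x)\<^sup>2 / (4 * \<eta>)))"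
      unfolding E_def
    proof (rule integral_mono)
      fix x
      have "\<bar>s * (v x - u x) - s * (v x - \<phi> n x)\<bar> = \<bar>\<phi> n x - u x\<bar>"
        using s by (auto simp: algebra_simps abs_minus_commute)
      also have "\<dots> \<le> \<eta> + (\<phi> n x - u x)\<^sup>2 / (4 * \<eta>)"
      proof -
        have "0 \<le> (2 * \<eta> - \<bar>\<phi> n x - u x\<bar>)\<^sup>2" by simp
        then have "4 * \<eta> * \<bar>\<phi> n x - u x\<bar> \<le> 4 * \<eta> * \<eta> + (\<phi> n x - u x)\<^sup>2"
          by (simp add: power2_diff) (simp add: power2_eq_square)
        then show ?thesis using \<eta> by (simp add: field_simps)
      qed
      finally show "bump (s * (v x - u x)) \<le> bump (s * (v x - \<phi> n x)) + 2 * (\<eta> + (\<phi> n x - u x)\<^sup>2 / (4 * \<eta>))"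
        by (intro order_trans[OF bump_lipschitz[of _ "s * (v x - \<phi> n x)"]] add_left_mono mult_left_mono) simp_all
    qed (use iE i1 i2 in auto)
    also have "\<dots> = (LINT x|M. bump (s * (v x - \<phi> n x))) + 2 * (\<eta> * measure M (space M) + B n / (4 * \<eta>))"
      using i1 i2 by (simp add: B_def)
    also have "(LINT x|M. bump (s * (v x - \<phi> n x))) \<le> A n / (2 * \<delta>)"
      using comparison_step[OF \<Omega> g u(2) v K s sign lap \<phi>(1), of n] \<delta>
      by (simp add: LM A_def field_simps)
    finally show ?thesis by simp
  qed
  note E_le = this
  have E: "E \<le> 2 * (\<eta> * measure M (space M))" if \<eta>: "\<eta> > 0" for \<eta>
  proof -
    have "(\<lambda>n. A n / (2 * \<delta>) + 2 * (\<eta> * measure M (space M) + B n / (4 * \<eta>)))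
        \<longlonglongrightarrow> 0 / (2 * \<delta>) + 2 * (\<eta> * measure M (space M) + 0 / (4 * \<eta>))"
      using \<eta> \<delta> by (intro tendsto_intros A B) auto
    then have "E \<le> 0 / (2 * \<delta>) + 2 * (\<eta> * measure M (space M) + 0 / (4 * \<eta>))"
      by (rule LIMSEQ_le_const) (use E_le[OF \<eta>] in blast)
    then show ?thesis by simp
  qed
  have "E \<le> 0"
  proof (rule field_le_epsilon)
    fix e :: real assume e: "e > 0"
    \<comment> \<open>The added 1 keeps this choice of \<open>\<eta>\<close> positive and finite
      even if the measure is 0.\<close>
    have "2 * (e / (2 * (measure M (space M) + 1)) * measure M (space M)) \<le> e"
    proof -
      have "2 * (e / (2 * (m + 1)) * m) \<le> e" if "m \<ge> 0" for m :: real
      proof -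
        have "2 * (e / (2 * (m + 1)) * m) = e * m / (m + 1)" using that by (simp add: field_simps)
        also have "\<dots> \<le> e" using that e by (simp add: pos_divide_le_eq algebra_simps)
        finally show ?thesis .
      qed
      then show ?thesis using measure_nonneg by blast
    qed
    then show "E \<le> 0 + e"
      using E[of "e / (2 * (measure M (space M) + 1))"] e measure_nonneg[of M "space M"]
      by (simp add: add_nonneg_pos)
  qed
  moreover have "E \<ge> 0" by (simp add: E_def bump_nonneg)
  ultimately have "E = 0" by simp
  then have "AE x in M. bump (s * (v x - u x)) = 0"
    using integral_nonneg_eq_0_iff_AE[OF iE] by (simp add: E_def bump_nonneg)
  then have "AE x in M. s * (v x - u x) \<le> 0"
    by eventually_elim (metis bump_pos_iff less_irrefl not_le)
  then show ?thesis unfolding M_def using \<Omega>(1) by (subst (asm) AE_restrict_space_iff) auto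
qed

subsection \<open>Barriers\<close>

lemma has_derivative_norm_sq_diff:
  "((\<lambda>x. c - (norm (x - y))\<^sup>2 / 4) has_derivative (\<lambda>h. - ((x - y) \<bullet> h) / 2)) (at x)"
  for y :: "'a::euclidean_space"
  unfolding power2_norm_eq_inner
  by (auto intro!: derivative_eq_intros simp: inner_commute)

lemma C_k_norm_sq_diff: "C_k k (\<lambda>x::'a::euclidean_space. c - (norm (x - y))\<^sup>2 / 4)"
proof -
  have "(\<lambda>x. c - (norm (x - y))\<^sup>2 / 4)
      = (\<lambda>x. c + (\<Sum>b\<in>Basis. (-1/4) * ((x \<bullet> b + (- (y \<bullet> b))) * (x \<bullet> b + (- (y \<bullet> b))))))"
    unfolding power2_norm_eq_inner
    by (subst euclidean_inner)
      (simp add: fun_eq_iff inner_diff_left sum_distrib_left[symmetric] sum_negf sum_divide_distrib)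
  then show ?thesis
    by (simp only:) (intro C_k_add C_k_const C_k_sum C_k_mult C_k_inner)
qed

lemma laplacian_comp:
  fixes w :: "'a::euclidean_space \<Rightarrow> real"
  assumes w: "C_k 2 w"
    and h: "\<And>t. (h has_real_derivative h1 t) (at t)" "\<And>t. (h1 has_real_derivative h2 t) (at t)"
  shows "laplacian (\<lambda>x. h (w x)) x = h2 (w x) * (grad w x \<bullet> grad w x) + h1 (w x) * laplacian w x"
proof -
  have w1: "C_k (Suc 0) w" using C_k_Suc_imp w by (metis numeral_2_eq_2)
  have dw: "w differentiable (at x)" for x using C_k_SucD(1)[OF w1] .
  have d2: "(\<lambda>y. frechet_derivative w (at y) b) differentiable (at x)" if "b \<in> Basis" for b x
    using w that by (simp add: numeral_2_eq_2)
  have "frechet_derivative (\<lambda>y. frechet_derivative (\<lambda>x. h (w x)) (at y) b) (at x) b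
      = h1 (w x) * frechet_derivative (\<lambda>y. frechet_derivative w (at y) b) (at x) b
       + h2 (w x) * (frechet_derivative w (at x) b * frechet_derivative w (at x) b)" if b: "b \<in> Basis" for b
  proof -
    note c = frechet_derivative_real_comp[OF h(2) dw]
    show ?thesis
      unfolding frechet_derivative_real_comp(2)[OF h(1) dw]
      using frechet_derivative_mult[OF c(1) d2[OF b]] by (simp add: c(2) mult.assoc)
  qed
  then show ?thesis
    unfolding laplacian_def inner_grad by (simp add: sum.distrib sum_distrib_left add.commute)
qed

text \<open>The factor 1/4 in the barriers is chosen for this: in dimension 2 the value is
  -1.\<close>

lemma laplacian_norm_sq_diff:
  "laplacian (\<lambda>x::'a::euclidean_space. c - (norm (x - y))\<^sup>2 / 4) x = - real DIM('a) / 2"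
proof -
  have 1: "frechet_derivative (\<lambda>x. c - (norm (x - y))\<^sup>2 / 4) (at x) b = (-1/2) * ((x - y) \<bullet> b)" for x b :: 'a
    using fun_cong[OF frechet_derivative_at[OF has_derivative_norm_sq_diff[of c y x]], of b] by simp
  have 2: "frechet_derivative (\<lambda>x. (-1/2) * ((x - y) \<bullet> b)) (at x) b = -1/2" if "b \<in> Basis" for b
  proof -
    have "((\<lambda>x. (-1/2) * ((x - y) \<bullet> b)) has_derivative (\<lambda>h. (-1/2) * (h \<bullet> b))) (at x)"
      by (auto intro!: derivative_eq_intros)
    from fun_cong[OF frechet_derivative_at[OF this, symmetric], of b] that show ?thesis by simp
  qed
  show ?thesis unfolding laplacian_def 1 by (subst sum.cong[OF refl 2]) auto
qed

lemma laplacian_scale: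
  assumes "C_k 2 w"
  shows "laplacian (\<lambda>x. a * w x) x = a * laplacian w x"
  using laplacian_comp[OF assms, of "\<lambda>t. a * t" "\<lambda>_. a" "\<lambda>_. 0" x]
  by (auto intro!: derivative_eq_intros)

text \<open>The paraboloid is nonnegative on the unit disc, so \<open>comparison\<close> applies
  with the empty compact set. The factor \<open>1 + 1 / real (Suc n)\<close> creates the strict
  margin and disappears in the limit.\<close>

lemma solution_upper_bound:
  fixes \<Omega> :: "(real ^ 2) set"
  assumes \<Omega>: "open \<Omega>" "\<Omega> \<subseteq> ball 0 1"
    and u: "u \<in> W12_0 \<Omega>" "weak_laplacian \<Omega> u (\<lambda>_. -1)"
  shows "AE x in lebesgue. x \<in> \<Omega> \<longrightarrow> u x \<le> (1 - (norm x)\<^sup>2) / 4"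
proof -
  have b: "bounded \<Omega>" using \<Omega>(2) bounded_ball bounded_subset by blast
  define W where "W = (\<lambda>x::real^2. 1/4 - (norm (x - 0))\<^sup>2 / 4)"
  have W_smooth: "C_k k W" for k unfolding W_def by (rule C_k_norm_sq_diff)
  have lapW: "laplacian W x = -1" for x unfolding W_def by (subst laplacian_norm_sq_diff) simp
  have W_pos: "W x \<ge> 0" if "x \<in> \<Omega>" for x
    using that \<Omega>(2) power_le_one[of "norm x" 2] by (fastforce simp: W_def)
  have "AE x in lebesgue. x \<in> \<Omega> \<longrightarrow> - 1 * ((1 + 1 / real (Suc n)) * W x - u x) \<le> 0" for n
  proof (rule comparison[OF \<Omega>(1) b u, of _ "{}" _ "1 / real (Suc n)"])
    show "C_k k (\<lambda>x. (1 + 1 / real (Suc n)) * W x)" for k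
      by (intro C_k_mult C_k_const W_smooth)
    show "1 / real (Suc n) \<le> - 1 * (laplacian (\<lambda>x. (1 + 1 / real (Suc n)) * W x) x + 1)" for x
      by (simp add: laplacian_scale[OF W_smooth] lapW)
  qed (use W_pos in \<open>auto intro!: mult_nonneg_nonneg simp: add_nonneg_nonneg\<close>)
  then have "AE x in lebesgue. \<forall>n. x \<in> \<Omega> \<longrightarrow> - 1 * ((1 + 1 / real (Suc n)) * W x - u x) \<le> 0"
    unfolding AE_all_countable by blast
  then show ?thesis
  proof eventually_elim
    fix x assume *: "\<forall>n. x \<in> \<Omega> \<longrightarrow> - 1 * ((1 + 1 / real (Suc n)) * W x - u x) \<le> 0"
    show "x \<in> \<Omega> \<longrightarrow> u x \<le> (1 - (norm x)\<^sup>2) / 4"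
    proof
      assume x: "x \<in> \<Omega>"
      have "(\<lambda>n. (1 + inverse (real (Suc n))) * W x) \<longlonglongrightarrow> (1 + 0) * W x"
        by (intro tendsto_intros LIMSEQ_inverse_real_of_nat)
      then have "u x \<le> (1 + 0) * W x"
        by (rule LIMSEQ_le_const) (use * x in \<open>auto simp: inverse_eq_divide\<close>)
      then show "u x \<le> (1 - (norm x)\<^sup>2) / 4" by (simp add: W_def diff_divide_distrib)
    qed
  qed
qed

text \<open>A smooth convex substitute for the positive part: truncating a paraboloid with it gives a
  compactly supported subsolution.\<close>

definition soft_pos :: "real \<Rightarrow> real" where "soft_pos t = t * bump t"

lemma soft_pos_has_derivative: "(soft_pos has_real_derivative flat [:1, 1:] t) (at t)"
proof -
  have "((\<lambda>t. t * bump t) has_real_derivative (1 * bump t + bump' t * t)) (at t)"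
    by (intro DERIV_mult DERIV_ident bump_has_derivative)
  moreover have "1 * bump t + bump' t * t = flat [:1, 1:] t"
    by (simp add: flat_def field_simps)
  ultimately show ?thesis by (simp add: soft_pos_def[abs_def])
qed

lemma soft_pos_deriv_has_derivative:
  "(flat [:1, 1:] has_real_derivative flat [:0, 0, 0, 1:] t) (at t)"
  using flat_has_derivative[of "[:1, 1:]" t] by (simp add: pderiv_pCons)

lemma soft_pos_deriv_le_1: "flat [:1, 1:] t \<le> 1"
proof (cases "t > 0")
  case True
  have "1 + 1 / t \<le> exp (1 / t)" by (rule exp_ge_add_one_self)
  then show ?thesis using True by (simp add: flat_def exp_minus field_simps)
qed (simp add: flat_def)

lemma soft_pos_scaled_tendsto:
  "t > 0 \<Longrightarrow> (\<lambda>n. inverse (real (Suc n)) * soft_pos (t / inverse (real (Suc n)))) \<longlonglongrightarrow> t"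
proof -
  assume t: "t > 0"
  have "(\<lambda>n. t * exp (- (inverse (real (Suc n)) / t))) \<longlonglongrightarrow> t * exp (- (0 / t))"
    using t by (intro tendsto_intros LIMSEQ_inverse_real_of_nat) auto
  moreover have "inverse (real (Suc n)) * soft_pos (t / inverse (real (Suc n)))
      = t * exp (- (inverse (real (Suc n)) / t))" for n
  proof -
    define e where "e = inverse (real (Suc n))"
    have "e > 0" by (simp add: e_def)
    then have "e * soft_pos (t / e) = t * exp (- (e / t))"
      using t by (simp add: soft_pos_def flat_def)
    then show ?thesis by (simp only: e_def)
  qed
  ultimately show ?thesis by simp
qed

text \<open>Here \<open>e\<close> is the smoothing scale of the positive part and
  \<open>1 - d\<close> creates the margin. The first derivative of \<open>h e\<close> is at most 1
  and the second is nonnegative, so composing with \<open>w\<close> keeps the Laplacian at least -1.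
  The limits are \<open>d\<close> to 0, then \<open>e\<close> to 0.\<close>

lemma solution_lower_bound_cball:
  fixes \<Omega> :: "(real ^ 2) set"
  assumes \<Omega>: "open \<Omega>" "bounded \<Omega>"
    and u: "u \<in> W12_0 \<Omega>" "weak_laplacian \<Omega> u (\<lambda>_. -1)"
    and ball: "cball y r \<subseteq> \<Omega>" "r \<ge> 0"
  shows "AE x in lebesgue. x \<in> \<Omega> \<longrightarrow> (r\<^sup>2 - (norm (x - y))\<^sup>2) / 4 \<le> u x"
proof -
  define w where "w = (\<lambda>x. r\<^sup>2 / 4 - (norm (x - y))\<^sup>2 / 4)"
  have w_smooth: "C_k k w" for k unfolding w_def by (rule C_k_norm_sq_diff)
  have lapw: "laplacian w x = -1" for x unfolding w_def by (subst laplacian_norm_sq_diff) simp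
  have w_out: "w x \<le> 0" if "x \<notin> cball y r" for x
    using that ball(2) power_mono[of r "norm (x - y)" 2] by (simp add: w_def dist_norm norm_minus_commute)
  define h where "h e t = e * soft_pos (t / e)" for e t
  have h1: "(h e has_real_derivative flat [:1, 1:] (t / e)) (at t)" if "e > 0" for e t
  proof -
    have "((\<lambda>t. e * soft_pos (t / e)) has_real_derivative e * (flat [:1, 1:] (t / e) * (1 / e))) (at t)"
      by (intro DERIV_cmult DERIV_chain2[OF soft_pos_has_derivative] DERIV_cdivide DERIV_ident)
    then show ?thesis using that by (simp add: h_def[abs_def])
  qed
  have h2: "((\<lambda>t. flat [:1, 1:] (t / e)) has_real_derivative flat [:0, 0, 0, 1:] (t / e) / e) (at t)" for e t
    using DERIV_chain2[OF soft_pos_deriv_has_derivative DERIV_cdivide[OF DERIV_ident, of e]] by simp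
  define v where "v d e x = (1 - d) * h e (w x)" for d e x
  have hw_smooth: "C_k k (\<lambda>x. h e (w x))" for k e
  proof -
    have "smooth soft_pos" by (rule smooth_antiderivative[OF smooth_flat soft_pos_has_derivative])
    then have "C_k k (\<lambda>x. soft_pos (w x * (1 / e)))"
      by (rule C_k_comp) (intro C_k_mult C_k_const w_smooth)
    then show ?thesis by (auto simp: h_def intro: C_k_mult C_k_const)
  qed
  have h_out: "h e t = 0" if "t \<le> 0" "e > 0" for e t
    using that by (auto simp: h_def soft_pos_def flat_def zero_less_divide_iff)
  have main: "AE x in lebesgue. x \<in> \<Omega> \<longrightarrow> 1 * (v d e x - u x) \<le> 0" if "0 < d" "d < 1" "e > 0" for d e
  proof (rule comparison[OF \<Omega> u, of _ "cball y r" _ d])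
    show "C_k k (v d e)" for k
      unfolding v_def[abs_def] by (intro C_k_mult C_k_const hw_smooth)
    show "1 * v d e x \<le> 0" if "x \<in> \<Omega> - cball y r" for x
      using that w_out \<open>e > 0\<close> by (simp add: v_def h_out)
    show "d \<le> 1 * (laplacian (v d e) x + 1)" for x
    proof -
      have "laplacian (\<lambda>x. h e (w x)) x
          = flat [:0, 0, 0, 1:] (w x / e) / e * (grad w x \<bullet> grad w x) - flat [:1, 1:] (w x / e)"
        using laplacian_comp[OF w_smooth h1[OF \<open>e > 0\<close>] h2, of x] by (simp add: lapw)
      moreover have "flat [:0, 0, 0, 1:] (w x / e) / e * (grad w x \<bullet> grad w x) \<ge> 0"
        using \<open>e > 0\<close> by (intro mult_nonneg_nonneg) (auto intro!: divide_nonneg_pos flat_nonneg)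
      ultimately have "- 1 \<le> laplacian (\<lambda>x. h e (w x)) x"
        using soft_pos_deriv_le_1[of "w x / e"] by linarith
      from mult_left_mono[OF this, of "1 - d"] \<open>d < 1\<close> show ?thesis
        by (simp add: v_def[abs_def] laplacian_scale[OF hw_smooth])
    qed
  qed (use ball that in auto)
  define q where "q n = inverse (real (Suc n))" for n
  have q: "0 < q n" for n by (simp add: q_def)
  \<comment> \<open>The index for \<open>d\<close> is shifted because \<open>q 0 = 1\<close>,
    whereas \<open>d < 1\<close> is required.\<close>
  have q1: "q (Suc n) < 1" for n by (simp add: q_def field_simps)
  have "AE x in lebesgue. \<forall>n m. x \<in> \<Omega> \<longrightarrow> v (q (Suc m)) (q n) x \<le> u x"
    unfolding AE_all_countable using main[OF q q1 q] by simp
  then show ?thesis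
  proof eventually_elim
    fix x assume *: "\<forall>n m. x \<in> \<Omega> \<longrightarrow> v (q (Suc m)) (q n) x \<le> u x"
    show "x \<in> \<Omega> \<longrightarrow> (r\<^sup>2 - (norm (x - y))\<^sup>2) / 4 \<le> u x"
    proof
      assume x: "x \<in> \<Omega>"
      have le: "h (q n) (w x) \<le> u x" for n
      proof -
        have "(\<lambda>m. (1 - q (Suc m)) * h (q n) (w x)) \<longlonglongrightarrow> (1 - 0) * h (q n) (w x)"
          unfolding q_def by (intro tendsto_intros LIMSEQ_Suc[OF LIMSEQ_inverse_real_of_nat])
        then have "(1 - 0) * h (q n) (w x) \<le> u x"
          by (rule LIMSEQ_le_const2) (use * x in \<open>auto simp: v_def\<close>)
        then show ?thesis by simp
      qed
      have "w x \<le> u x"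
      proof (cases "w x > 0")
        case True
        show ?thesis
          by (rule LIMSEQ_le_const2[OF soft_pos_scaled_tendsto[OF True]])
            (use le in \<open>auto simp: h_def q_def\<close>)
      next
        case False
        then show ?thesis using le[of 0] h_out[of "w x" "q 0"] q[of 0] by simp
      qed
      then show "(r\<^sup>2 - (norm (x - y))\<^sup>2) / 4 \<le> u x" by (simp add: w_def diff_divide_distrib)
    qed
  qed
qed

text \<open>The balls needed later touch the boundary, so their closures leave the open domain; they
  are exhausted by smaller closed balls and the radius passes to the limit.\<close>

lemma solution_lower_bound_ball:
  fixes \<Omega> :: "(real ^ 2) set"
  assumes \<Omega>: "open \<Omega>" "bounded \<Omega>"
    and u: "u \<in> W12_0 \<Omega>" "weak_laplacian \<Omega> u (\<lambda>_. -1)"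
    and ball: "ball y r \<subseteq> \<Omega>" "r > 0"
  shows "AE x in lebesgue. x \<in> \<Omega> \<longrightarrow> (r\<^sup>2 - (norm (x - y))\<^sup>2) / 4 \<le> u x"
proof -
  define \<rho> where "\<rho> n = r * (1 - inverse (real (Suc n)))" for n
  have "cball y (\<rho> n) \<subseteq> \<Omega>" "\<rho> n \<ge> 0" for n
  proof -
    have "\<rho> n < r" using ball(2) by (simp add: \<rho>_def)
    then have "cball y (\<rho> n) \<subseteq> ball y r" by auto
    then show "cball y (\<rho> n) \<subseteq> \<Omega>" using ball(1) by (rule subset_trans)
    show "\<rho> n \<ge> 0" using ball(2) by (simp add: \<rho>_def field_simps)
  qed
  then have "AE x in lebesgue. \<forall>n. x \<in> \<Omega> \<longrightarrow> ((\<rho> n)\<^sup>2 - (norm (x - y))\<^sup>2) / 4 \<le> u x"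
    unfolding AE_all_countable using solution_lower_bound_cball[OF \<Omega> u] by blast
  then show ?thesis
  proof eventually_elim
    fix x assume *: "\<forall>n. x \<in> \<Omega> \<longrightarrow> ((\<rho> n)\<^sup>2 - (norm (x - y))\<^sup>2) / 4 \<le> u x"
    have "(\<lambda>n. ((\<rho> n)\<^sup>2 - (norm (x - y))\<^sup>2) / 4) \<longlonglongrightarrow> ((r * (1 - 0))\<^sup>2 - (norm (x - y))\<^sup>2) / 4"
      unfolding \<rho>_def by (intro tendsto_intros LIMSEQ_inverse_real_of_nat) auto
    from LIMSEQ_le_const2[OF this] * show "x \<in> \<Omega> \<longrightarrow> (r\<^sup>2 - (norm (x - y))\<^sup>2) / 4 \<le> u x"
      by auto
  qed
qed

subsection \<open>Geometry of regular polygons\<close>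

definition dir :: "real \<Rightarrow> real ^ 2" where "dir \<alpha> = vector [cos \<alpha>, sin \<alpha>]"

lemma dir_inner: "dir \<alpha> \<bullet> dir \<gamma> = cos (\<alpha> - \<gamma>)"
  by (simp add: dir_def inner_vec_def sum_2 cos_diff)

lemma norm_dir [simp]: "norm (dir \<alpha>) = 1"
  by (simp add: norm_eq_sqrt_inner dir_inner)

lemma dir_nonzero [simp]: "dir \<alpha> \<noteq> 0"
  using norm_dir[of \<alpha>] by fastforce

lemma polar_form: obtains \<alpha> where "x = norm x *\<^sub>R dir \<alpha>"
proof (cases "x = 0")
  case False
  define a b where "a = x $ 1 / norm x" and "b = x $ 2 / norm x"
  have "(norm x)\<^sup>2 = (x $ 1)\<^sup>2 + (x $ 2)\<^sup>2"
    unfolding power2_norm_eq_inner by (simp add: inner_vec_def sum_2 power2_eq_square)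
  moreover have "(norm x)\<^sup>2 \<noteq> 0" using False by simp
  ultimately have "a\<^sup>2 + b\<^sup>2 = 1"
    unfolding a_def b_def power_divide by (metis add_divide_distrib divide_self)
  then obtain t where "a = cos t" "b = sin t" using sincos_total_2pi by metis
  moreover have "x $ 1 = norm x * a" "x $ 2 = norm x * b" using False by (simp_all add: a_def b_def)
  ultimately have "x = norm x *\<^sub>R dir t"
    by (simp add: dir_def vec_eq_iff forall_2)
  then show thesis by (rule that)
qed (use that in simp)

text \<open>Rounding the angle, measured in steps of \<open>2 * pi / N\<close>, to the nearest
  integer leaves at most half a step; reduction modulo \<open>N\<close> gives \<open>k\<close>, and
  the quotient becomes \<open>m\<close>. It serves both for the nearest vertex and for the nearest
  side.\<close>

lemma exists_nearby_angle:
  fixes \<alpha> \<theta> :: real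
  assumes "N > 0"
  obtains k :: nat and m :: int and t :: real
  where "k < N" "\<bar>t\<bar> \<le> pi / N" "\<alpha> = \<theta> + 2 * pi * real k / real N + t + 2 * pi * m"
proof -
  define z where "z = (\<alpha> - \<theta>) * N / (2 * pi)"
  define j where "j = round z"
  define t where "t = (z - j) * (2 * pi / N)"
  define k where "k = nat (j mod int N)"
  have j: "real_of_int j = real_of_int (j div int N) * real N + real k"
  proof -
    have "j = (j div int N) * int N + int k" using assms by (simp add: k_def)
    then have "real_of_int j = real_of_int ((j div int N) * int N + int k)" by simp
    then show ?thesis by simp
  qed
  have "\<bar>z - j\<bar> \<le> 1 / 2" using of_int_round_abs_le[of z] by (simp add: j_def abs_minus_commute)
  then have "\<bar>z - j\<bar> * (2 * pi / N) \<le> 1 / 2 * (2 * pi / N)"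
    by (rule mult_right_mono) auto
  then have "\<bar>t\<bar> \<le> pi / N" by (simp add: t_def abs_mult)
  moreover have "k < N" using assms by (simp add: k_def nat_less_iff)
  moreover have "\<alpha> = \<theta> + 2 * pi * real k / real N + t + 2 * pi * (j div int N)"
  proof -
    have "\<alpha> = \<theta> + z * (2 * pi / N)" using assms by (simp add: z_def)
    also have "\<dots> = \<theta> + j * (2 * pi / N) + t" unfolding t_def left_diff_distrib by simp
    also have "\<dots> = \<theta> + 2 * pi * real k / real N + t + 2 * pi * (j div int N)"
      using assms unfolding j by (simp add: field_simps)
    finally show ?thesis .
  qed
  ultimately show thesis using that by blast
qed

lemma dir_add_2pi_int: "dir (\<alpha> + 2 * pi * of_int m) = dir \<alpha>"
  by (simp add: dir_def cos_add sin_add)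

locale polygon =
  fixes N :: nat and \<theta> :: real
  assumes N: "N \<ge> 3"
begin

definition vertex :: "nat \<Rightarrow> real ^ 2" where "vertex k = dir (\<theta> + 2 * pi * real k / real N)"
definition pgon :: "(real ^ 2) set" where "pgon = convex hull (vertex ` {..<N})"
definition c :: real where "c = cos (pi / N)"
definition \<sigma> :: real where "\<sigma> = sin (pi / N)"

text \<open>The outer unit normal of the side from \<open>vertex k\<close> to \<open>vertex (Suc k)\<close> is \<open>dir (mid k)\<close>; indices of
  vertices are taken modulo \<open>N\<close>.\<close>

definition mid :: "nat \<Rightarrow> real" where "mid k = \<theta> + pi / N + 2 * pi * real k / real N"

abbreviation "\<Omega> \<equiv> interior pgon"

lemma regular_polygon_eq: "regular_polygon \<theta> N = \<Omega>"
  by (simp add: regular_polygon_def pgon_def vertex_def[abs_def] dir_def)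

lemma pi_N: "0 < pi / N" "pi / N \<le> pi / 3" "pi / N < pi"
proof -
  show "0 < pi / N" "pi / N \<le> pi / 3"
    using N divide_left_mono[of 3 "real N" pi] by auto
  then show "pi / N < pi" using pi_gt_zero by linarith
qed

lemma c_ge: "c \<ge> 1 / 2"
  using pi_N cos_monotone_0_pi_le[of "pi / N" "pi / 3"] by (simp add: c_def cos_60)

lemma c_lt_1: "c < 1"
  using pi_N cos_monotone_0_pi[of 0 "pi / N"] by (simp add: c_def)

lemma \<sigma>_pos: "\<sigma> > 0"
  unfolding \<sigma>_def by (rule sin_gt_zero) (use pi_N pi_gt_zero in linarith)+

lemma \<sigma>_le: "\<sigma> \<le> pi / N"
  unfolding \<sigma>_def using pi_N by (intro sin_x_le_x) auto

lemma c_\<sigma>: "c\<^sup>2 + \<sigma>\<^sup>2 = 1"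
  by (simp add: c_def \<sigma>_def)

text \<open>Unrestricted \<open>k\<close>, because the last side ends at
  \<open>vertex N\<close>.\<close>

lemma vertex_in_hull: "vertex k \<in> pgon"
proof -
  have "real k = real (k mod N) + real N * real (k div N)"
    by (metis mod_mult_div_eq of_nat_add of_nat_mult)
  then have "\<theta> + 2 * pi * real k / real N = (\<theta> + 2 * pi * real (k mod N) / real N) + 2 * pi * of_int (int (k div N))"
    using N by (simp add: field_simps)
  then have "vertex k = vertex (k mod N)" unfolding vertex_def by (metis dir_add_2pi_int)
  moreover have "vertex (k mod N) \<in> vertex ` {..<N}" using N by auto
  ultimately show ?thesis unfolding pgon_def by (metis hull_inc)
qed

lemma vertex_mid: "vertex k = dir (mid k - pi / N)" "vertex (Suc k) = dir (mid k + pi / N)"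
proof -
  have "\<theta> + 2 * pi * real k / N = mid k - pi / N" "\<theta> + 2 * pi * real (Suc k) / N = mid k + pi / N"
    using N by (simp_all add: mid_def field_simps)
  then show "vertex k = dir (mid k - pi / N)" "vertex (Suc k) = dir (mid k + pi / N)"
    by (simp_all only: vertex_def)
qed

lemma convex_hull_vertices: "convex pgon" "compact pgon"
  by (simp_all add: pgon_def finite_imp_compact_convex_hull)

lemma hull_subset_cball: "pgon \<subseteq> cball 0 1"
  unfolding pgon_def by (rule hull_minimal) (auto simp: vertex_def)

lemma \<Omega>_subset_ball: "\<Omega> \<subseteq> ball 0 1"
  using interior_mono[OF hull_subset_cball] by simp

lemma cos_between: "\<lbrakk>pi / N \<le> \<bar>t\<bar>; \<bar>t\<bar> \<le> 2 * pi - pi / N\<rbrakk> \<Longrightarrow> cos t \<le> c"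
proof -
  assume t: "pi / N \<le> \<bar>t\<bar>" "\<bar>t\<bar> \<le> 2 * pi - pi / N"
  show "cos t \<le> c"
  proof (cases "\<bar>t\<bar> \<le> pi")
    case True
    then show ?thesis using t pi_N cos_monotone_0_pi_le[of "pi / N" "\<bar>t\<bar>"] by (simp add: c_def)
  next
    case False
    have "cos \<bar>t\<bar> = cos (2 * pi - \<bar>t\<bar>)" by (simp add: cos_diff)
    then show ?thesis using t False pi_N cos_monotone_0_pi_le[of "pi / N" "2 * pi - \<bar>t\<bar>"]
      by (simp add: c_def)
  qed
qed

lemma \<Omega>_halfplane:
  assumes "k < N" "x \<in> \<Omega>"
  shows "x \<bullet> dir (mid k) < c"
proof -
  have "vertex j \<bullet> dir (mid k) \<le> c" if "j < N" for j
  proof -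
    \<comment> \<open>The angle between a vertex and a side normal is an odd multiple of
      \<open>pi / N\<close>; being odd, \<open>i\<close> is nonzero, and its range keeps the angle
      at least \<open>pi / N\<close> away from 0 modulo \<open>2 * pi\<close>.\<close>
    define i where "i = 2 * (int j - int k) - 1"
    have i: "\<bar>i\<bar> \<ge> 1" "\<bar>i\<bar> \<le> 2 * int N - 1" using that assms(1) unfolding i_def by presburger+
    have "vertex j \<bullet> dir (mid k) = cos (of_int i * (pi / N))"
      unfolding vertex_def mid_def dir_inner i_def
      by (rule arg_cong[of _ _ cos]) (use N in \<open>simp add: field_simps\<close>)
    also have "\<dots> \<le> c"
    proof (rule cos_between)
      have a: "\<bar>of_int i * (pi / N)\<bar> = of_int \<bar>i\<bar> * (pi / N)" by (simp add: abs_mult)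
      have "1 \<le> real_of_int \<bar>i\<bar>" using i(1) by linarith
      then show "pi / N \<le> \<bar>of_int i * (pi / N)\<bar>"
        unfolding a using mult_right_mono[of 1 "real_of_int \<bar>i\<bar>" "pi / N"] by simp
      have "real_of_int \<bar>i\<bar> \<le> real_of_int (2 * int N - 1)" using i(2) by linarith
      then have "real_of_int \<bar>i\<bar> * (pi / N) \<le> (2 * real N - 1) * (pi / N)"
        by (intro mult_right_mono) auto
      also have "\<dots> = 2 * pi - pi / N" using N by (simp add: field_simps)
      finally show "\<bar>of_int i * (pi / N)\<bar> \<le> 2 * pi - pi / N" unfolding a .
    qed
    finally show ?thesis .
  qed
  then have "pgon \<subseteq> {x. dir (mid k) \<bullet> x \<le> c}"
    unfolding pgon_def by (intro hull_minimal convex_halfspace_le) (auto simp: inner_commute)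
  \<comment> \<open>Passing to interiors makes the inequality strict.\<close>
  from interior_mono[OF this] have "\<Omega> \<subseteq> {x. dir (mid k) \<bullet> x < c}"
    by (simp add: interior_halfspace_le)
  then show ?thesis using assms(2) by (auto simp: inner_commute)
qed

text \<open>If \<open>x\<close> could be separated from the polygon, the separating direction
  \<open>- a\<close> would be within angle \<open>pi / N\<close> of some vertex, whose product with
  it is at least \<open>norm a * c\<close>; a point of norm below \<open>c\<close> cannot lie beyond
  that.\<close>

lemma ball_c_subset_hull: "ball 0 c \<subseteq> pgon"
proof
  fix x :: "real ^ 2"
  assume x: "x \<in> ball 0 c"
  show "x \<in> pgon"
  proof (rule ccontr)
    assume "x \<notin> pgon"
    then obtain a b where ab: "a \<bullet> x < b" "\<And>z. z \<in> pgon \<Longrightarrow> b < a \<bullet> z"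
      using separating_hyperplane_closed_point[of pgon x] convex_hull_vertices compact_imp_closed by blast
    obtain \<alpha> where \<alpha>: "- a = norm (- a) *\<^sub>R dir \<alpha>" by (rule polar_form)
    have "N > 0" using N by simp
    then obtain k m t where k: "k < N" "\<bar>t\<bar> \<le> pi / N" "\<alpha> = \<theta> + 2 * pi * real k / real N + t + 2 * pi * of_int m"
      by (rule exists_nearby_angle)
    have "dir \<alpha> = dir (\<theta> + 2 * pi * real k / real N + t)" unfolding k(3) by (rule dir_add_2pi_int)
    then have "dir \<alpha> \<bullet> vertex k = cos \<bar>t\<bar>" by (simp add: vertex_def dir_inner)
    also have "\<dots> \<ge> c" unfolding c_def
      using k(2) pi_N pi_gt_zero by (intro cos_monotone_0_pi_le) auto
    finally have "norm a * c \<le> norm a * (dir \<alpha> \<bullet> vertex k)" by (intro mult_left_mono) auto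
    also have "\<dots> = - a \<bullet> vertex k" by (subst \<alpha>) simp
    also have "\<dots> < - (a \<bullet> x)" using ab(1) ab(2)[OF vertex_in_hull[of k]] by simp
    also have "\<dots> \<le> norm a * norm x" using Cauchy_Schwarz_ineq2[of a x] by linarith
    also have "\<dots> \<le> norm a * c" using x by (intro mult_left_mono) auto
    finally show False by simp
  qed
qed

text \<open>The homothety with centre \<open>vertex k\<close> and ratio \<open>1 - s\<close> maps
  the convex polygon into itself and the incircle onto the boundary of this ball.\<close>

lemma ball_subset_\<Omega>:
  assumes "0 \<le> s" "s < 1"
  shows "ball (s *\<^sub>R vertex k) ((1 - s) * c) \<subseteq> \<Omega>"
proof (rule interior_maximal)
  show "ball (s *\<^sub>R vertex k) ((1 - s) * c) \<subseteq> pgon"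
  proof
    fix z assume z: "z \<in> ball (s *\<^sub>R vertex k) ((1 - s) * c)"
    define w where "w = (1 / (1 - s)) *\<^sub>R (z - s *\<^sub>R vertex k)"
    have "norm (z - s *\<^sub>R vertex k) < (1 - s) * c" using z by (simp add: dist_norm norm_minus_commute)
    moreover have "norm w = norm (z - s *\<^sub>R vertex k) / (1 - s)" using assms by (simp add: w_def)
    ultimately have "norm w < c" using assms by (simp add: pos_divide_less_eq mult.commute)
    then have "w \<in> pgon" using ball_c_subset_hull by auto
    then have "(1 - s) *\<^sub>R w + s *\<^sub>R vertex k \<in> pgon"
      using assms by (intro convexD[OF convex_hull_vertices(1)] vertex_in_hull) auto
    then show "z \<in> pgon" using assms by (simp add: w_def)
  qed
qed simp

text \<open>Normal and tangential coordinates at the nearest side, in which its ends are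
  \<open>(c, - \<sigma>)\<close> and \<open>(c, \<sigma>)\<close>. The inequality says that the
  polar angle from the normal is at most \<open>pi / N\<close>, without division; it comes from
  \<open>sin (pi / N - \<bar>t\<bar>) \<ge> 0\<close>.\<close>

lemma sector:
  obtains k where "k < N" "\<bar>x \<bullet> dir (mid k + pi / 2)\<bar> * c \<le> (x \<bullet> dir (mid k)) * \<sigma>"
    "(norm x)\<^sup>2 = (x \<bullet> dir (mid k))\<^sup>2 + (x \<bullet> dir (mid k + pi / 2))\<^sup>2"
    "x \<bullet> vertex k = (x \<bullet> dir (mid k)) * c - (x \<bullet> dir (mid k + pi / 2)) * \<sigma>"
    "x \<bullet> vertex (Suc k) = (x \<bullet> dir (mid k)) * c + (x \<bullet> dir (mid k + pi / 2)) * \<sigma>"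
proof -
  obtain \<alpha> where \<alpha>: "x = norm x *\<^sub>R dir \<alpha>" by (rule polar_form)
  have "N > 0" using N by simp
  then obtain k m t where k: "k < N" "\<bar>t\<bar> \<le> pi / N"
    "\<alpha> = \<theta> + pi / N + 2 * pi * real k / real N + t + 2 * pi * of_int m"
    by (rule exists_nearby_angle)
  define r where "r = norm x"
  have "dir \<alpha> = dir (mid k + t)" unfolding k(3) mid_def by (rule dir_add_2pi_int)
  then have x: "x = r *\<^sub>R dir (mid k + t)" using \<alpha> by (simp add: r_def)
  have r: "r \<ge> 0" by (simp add: r_def)
  have a: "x \<bullet> dir (mid k) = r * cos t" by (simp add: x dir_inner)
  have y: "x \<bullet> dir (mid k + pi / 2) = r * sin t" by (simp add: x dir_inner cos_diff)
  have "sin \<bar>t\<bar> = \<bar>sin t\<bar>"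
  proof -
    have "\<bar>t\<bar> \<le> pi" using k(2) pi_N(3) by linarith
    then have "sin \<bar>t\<bar> \<ge> 0" by (intro sin_ge_zero) auto
    then show ?thesis by (cases "t \<ge> 0") auto
  qed
  moreover have "sin (pi / N - \<bar>t\<bar>) \<ge> 0"
    using k(2) pi_N pi_gt_zero by (intro sin_ge_zero) auto
  ultimately have "\<bar>sin t\<bar> * c \<le> cos t * \<sigma>"
    by (simp add: sin_diff c_def \<sigma>_def mult.commute)
  then have "r * (\<bar>sin t\<bar> * c) \<le> r * (cos t * \<sigma>)" using r by (rule mult_left_mono)
  then have 1: "\<bar>x \<bullet> dir (mid k + pi / 2)\<bar> * c \<le> (x \<bullet> dir (mid k)) * \<sigma>"
    unfolding a y using r by (simp add: abs_mult mult.assoc)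
  have "(r * cos t)\<^sup>2 + (r * sin t)\<^sup>2 = r\<^sup>2 * ((cos t)\<^sup>2 + (sin t)\<^sup>2)"
    by (simp only: power_mult_distrib distrib_left)
  then have 2: "(norm x)\<^sup>2 = (x \<bullet> dir (mid k))\<^sup>2 + (x \<bullet> dir (mid k + pi / 2))\<^sup>2"
    unfolding a y by (simp add: r_def)
  have 3: "x \<bullet> vertex k = (x \<bullet> dir (mid k)) * c - (x \<bullet> dir (mid k + pi / 2)) * \<sigma>"
    unfolding a y by (simp add: x vertex_mid(1) dir_inner c_def \<sigma>_def cos_add algebra_simps)
  have 4: "x \<bullet> vertex (Suc k) = (x \<bullet> dir (mid k)) * c + (x \<bullet> dir (mid k + pi / 2)) * \<sigma>"
    unfolding a y by (simp add: x vertex_mid(2) dir_inner c_def \<sigma>_def cos_diff algebra_simps)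
  show thesis by (rule that[OF k(1) 1 2 3 4])
qed

text \<open>The ball used here is the incircle shrunk towards the nearest vertex so that its centre projects
  onto the same point of the nearest side as \<open>x\<close> does.\<close>

lemma lower_bound_in_sector:
  assumes x: "x \<in> \<Omega>"
  obtains k where "k < N" "x \<bullet> dir (mid k) < c" "\<bar>x \<bullet> dir (mid k + pi / 2)\<bar> < \<sigma>"
    "(norm x)\<^sup>2 = (x \<bullet> dir (mid k))\<^sup>2 + (x \<bullet> dir (mid k + pi / 2))\<^sup>2" "0 \<le> x \<bullet> dir (mid k)"
    "\<exists>s j. 0 \<le> s \<and> s < 1 \<and> c / 4 * ((c - x \<bullet> dir (mid k)) * (1 - \<bar>x \<bullet> dir (mid k + pi / 2)\<bar> / \<sigma>))
        \<le> (((1 - s) * c)\<^sup>2 - (norm (x - s *\<^sub>R vertex j))\<^sup>2) / 4"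
proof -
  obtain k where k: "k < N" "\<bar>x \<bullet> dir (mid k + pi / 2)\<bar> * c \<le> (x \<bullet> dir (mid k)) * \<sigma>"
    "(norm x)\<^sup>2 = (x \<bullet> dir (mid k))\<^sup>2 + (x \<bullet> dir (mid k + pi / 2))\<^sup>2"
    "x \<bullet> vertex k = (x \<bullet> dir (mid k)) * c - (x \<bullet> dir (mid k + pi / 2)) * \<sigma>"
    "x \<bullet> vertex (Suc k) = (x \<bullet> dir (mid k)) * c + (x \<bullet> dir (mid k + pi / 2)) * \<sigma>"
    by (rule sector)
  define a y where "a = x \<bullet> dir (mid k)" and "y = x \<bullet> dir (mid k + pi / 2)"
  note k = k[folded a_def y_def]
  have c0: "c > 0" using c_ge by simp
  have ac: "a < c" unfolding a_def by (rule \<Omega>_halfplane[OF k(1) x])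
  have a0: "a \<ge> 0"
    using k(2) c0 \<sigma>_pos by (metis abs_ge_zero mult_nonneg_nonneg order_trans zero_le_mult_iff not_less order_less_imp_le)
  have "\<bar>y\<bar> * c < c * \<sigma>" using k(2) mult_strict_right_mono[OF ac \<sigma>_pos] by linarith
  then have y\<sigma>: "\<bar>y\<bar> < \<sigma>" using c0 by (simp add: mult.commute)
  define s where "s = \<bar>y\<bar> / \<sigma>"
  have s: "0 \<le> s" "s < 1" using y\<sigma> \<sigma>_pos by (auto simp: s_def)
  have s\<sigma>: "s * \<sigma> = \<bar>y\<bar>" using \<sigma>_pos by (simp add: s_def)
  have sc: "s * c \<le> a" using k(2) \<sigma>_pos by (simp add: s_def field_simps)
  define j where "j = (if y \<ge> 0 then Suc k else k)"
  have xj: "x \<bullet> vertex j = a * c + \<bar>y\<bar> * \<sigma>" using k(4,5) by (auto simp: j_def)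
  have "(norm (x - s *\<^sub>R vertex j))\<^sup>2 = (norm x)\<^sup>2 - 2 * s * (x \<bullet> vertex j) + s\<^sup>2"
    by (simp add: power2_norm_eq_inner inner_simps inner_commute vertex_def dir_inner)
      (simp add: power2_eq_square)
  \<comment> \<open>Splitting the unit vertex into its normal part \<open>c\<close> and tangential
    part \<open>\<sigma>\<close> lets the squares complete separately; the tangential one then
    vanishes by the choice of \<open>s\<close>.\<close>
  also have "s\<^sup>2 = s\<^sup>2 * (c\<^sup>2 + \<sigma>\<^sup>2)" by (simp add: c_\<sigma>)
  also have "(norm x)\<^sup>2 - 2 * s * (x \<bullet> vertex j) + s\<^sup>2 * (c\<^sup>2 + \<sigma>\<^sup>2)
      = (a - s * c)\<^sup>2 + (\<bar>y\<bar> - s * \<sigma>)\<^sup>2"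
    unfolding k(3) xj by (simp add: power2_eq_square algebra_simps)
  finally have n: "(norm (x - s *\<^sub>R vertex j))\<^sup>2 = (a - s * c)\<^sup>2" by (simp add: s\<sigma>)
  \<comment> \<open>The right side is a factored difference of squares; dropping
    \<open>a - s * c\<close>, which is nonnegative in the sector, leaves a product of one-variable
    factors.\<close>
  have "(c - a) * ((1 - s) * c) \<le> (c - a) * ((1 - s) * c + (a - s * c))"
    using ac sc by (intro mult_left_mono) auto
  then have "c * ((c - a) * (1 - s)) \<le> (c - a) * ((1 - s) * c + (a - s * c))"
    by (simp only: mult_ac)
  also have "\<dots> = ((1 - s) * c)\<^sup>2 - (a - s * c)\<^sup>2"
    by (simp add: power2_eq_square algebra_simps)
  finally have "c / 4 * ((c - a) * (1 - \<bar>y\<bar> / \<sigma>)) \<le> (((1 - s) * c)\<^sup>2 - (norm (x - s *\<^sub>R vertex j))\<^sup>2) / 4"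
    unfolding n s_def[symmetric] by simp
  then show thesis
    using that[OF k(1)] ac y\<sigma> k(3) a0 s unfolding a_def y_def by blast
qed

end

subsection \<open>Integrals of powers\<close>

lemma emeasure_lborel_orthogonal_image:
  fixes h :: "real ^ 2 \<Rightarrow> real ^ 2"
  assumes h: "orthogonal_transformation h" and "h ` box l u \<in> sets borel"
  shows "emeasure lborel (h ` box l u) = emeasure lborel (box l u)"
proof -
  have l: "h ` box l u \<in> lmeasurable" "measure lebesgue (h ` box l u) = measure lebesgue (box l u)"
    using measurable_orthogonal_image[OF h] measure_orthogonal_image[OF h] by simp_all
  have "emeasure lborel (h ` box l u) = emeasure lebesgue (h ` box l u)"
    using assms(2) by (simp add: emeasure_completion)
  also have "\<dots> = emeasure lebesgue (box l u)"
    using l by (simp add: emeasure_eq_measure2)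
  also have "\<dots> = emeasure lborel (box l u)"
    by (simp add: emeasure_completion)
  finally show ?thesis .
qed

lemma dir_components: "dir \<phi> $ 1 = cos \<phi>" "dir \<phi> $ 2 = sin \<phi>"
  by (simp_all add: dir_def)

lemma orthogonal_decomposition:
  "x = (x \<bullet> dir \<phi>) *\<^sub>R dir \<phi> + (x \<bullet> dir (\<phi> + pi / 2)) *\<^sub>R dir (\<phi> + pi / 2)"
proof -
  have "x $ i = x $ i * (cos \<phi> * cos \<phi> + sin \<phi> * sin \<phi>)" for i
    by (simp add: sin_cos_squared_add3)
  moreover have "x $ 1 * (cos \<phi> * cos \<phi> + sin \<phi> * sin \<phi>)
      = (x $ 1 * cos \<phi> + x $ 2 * sin \<phi>) * cos \<phi> + (x $ 2 * cos \<phi> - x $ 1 * sin \<phi>) * (- sin \<phi>)"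
    and "x $ 2 * (cos \<phi> * cos \<phi> + sin \<phi> * sin \<phi>)
      = (x $ 1 * cos \<phi> + x $ 2 * sin \<phi>) * sin \<phi> + (x $ 2 * cos \<phi> - x $ 1 * sin \<phi>) * cos \<phi>"
    by (simp_all add: algebra_simps del: sin_cos_squared_add3)
  ultimately have "x $ 1 = (x $ 1 * cos \<phi> + x $ 2 * sin \<phi>) * cos \<phi> + (x $ 2 * cos \<phi> - x $ 1 * sin \<phi>) * (- sin \<phi>)"
    and "x $ 2 = (x $ 1 * cos \<phi> + x $ 2 * sin \<phi>) * sin \<phi> + (x $ 2 * cos \<phi> - x $ 1 * sin \<phi>) * cos \<phi>"
    by metis+
  then show ?thesis
    by (simp add: vec_eq_iff forall_2 dir_components inner_vec_def sum_2 cos_add sin_add)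
qed

text \<open>The passage to pairs makes Tonelli available. Boxes determine \<open>lborel\<close>, and
  the preimage of a box is the image of a box under an orthogonal map.\<close>

lemma lborel_distr_orthogonal_coordinates:
  "distr lborel borel (\<lambda>x. (x \<bullet> dir \<phi>, x \<bullet> dir (\<phi> + pi / 2))) = lborel"
proof (rule lborel_eqI[symmetric], clarify)
  fix la lb ua ub :: real
  assume le: "\<And>a b. (a, b) \<in> Basis \<Longrightarrow> (la, lb) \<bullet> (a, b) \<le> (ua, ub) \<bullet> (a, b)"
  have le': "la \<le> ua" "lb \<le> ub" using le[of 1 0] le[of 0 1] by (auto simp: Basis_prod_def)
  define T where "T = (\<lambda>x. (x \<bullet> dir \<phi>, x \<bullet> dir (\<phi> + pi / 2)))"
  define h where "h = (\<lambda>z::real^2. (z $ 1) *\<^sub>R dir \<phi> + (z $ 2) *\<^sub>R dir (\<phi> + pi / 2))"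
  define B where "B = box (vector [la, lb]) (vector [ua, ub] :: real ^ 2)"
  have meas: "T \<in> borel_measurable borel"
    unfolding T_def by (intro borel_measurable_continuous_onI continuous_intros)
  have inner_h: "h z \<bullet> dir \<phi> = z $ 1" "h z \<bullet> dir (\<phi> + pi / 2) = z $ 2" for z
    by (simp_all add: h_def inner_add_left dir_inner)
  have h: "orthogonal_transformation h"
  proof -
    have "linear h" by (rule linearI) (simp_all add: h_def algebra_simps)
    moreover have "h z \<bullet> h w = z \<bullet> w" for z w
    proof -
      have "z \<bullet> w = w $ 1 * z $ 1 + w $ 2 * z $ 2" by (simp add: inner_vec_def sum_2)
      moreover have "h z \<bullet> h w = w $ 1 * (h z \<bullet> dir \<phi>) + w $ 2 * (h z \<bullet> dir (\<phi> + pi / 2))"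
        by (subst (2) h_def) (simp add: inner_add_right)
      ultimately show ?thesis by (simp only: inner_h)
    qed
    ultimately show ?thesis by (simp add: orthogonal_transformation_def)
  qed
  have hT: "h (vector [x \<bullet> dir \<phi>, x \<bullet> dir (\<phi> + pi / 2)]) = x" for x
    unfolding h_def using orthogonal_decomposition[of x \<phi>, symmetric] by simp
  have mem: "z \<in> B \<longleftrightarrow> (z $ 1, z $ 2) \<in> box (la, lb) (ua, ub)" for z
    by (auto simp: B_def mem_box_cart forall_2 box_prod mem_box_real)
  have pre: "T -` box (la, lb) (ua, ub) = h ` B"
  proof (intro equalityI subsetI)
    fix x assume "x \<in> T -` box (la, lb) (ua, ub)"
    then have "vector [x \<bullet> dir \<phi>, x \<bullet> dir (\<phi> + pi / 2)] \<in> B" by (simp add: mem T_def)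
    then show "x \<in> h ` B" using hT[of x] by (metis imageI)
  next
    fix x assume "x \<in> h ` B"
    then show "x \<in> T -` box (la, lb) (ua, ub)" by (auto simp: T_def inner_h mem)
  qed
  have "T -` box (la, lb) (ua, ub) \<in> sets borel"
    using measurable_sets[OF meas, of "box (la, lb) (ua, ub)"] by simp
  then have hB: "h ` B \<in> sets borel" by (simp add: pre)
  have "emeasure (distr lborel borel T) (box (la, lb) (ua, ub)) = emeasure lborel (h ` B)"
    using meas by (simp add: emeasure_distr pre)
  also have "\<dots> = emeasure lborel B"
    using emeasure_lborel_orthogonal_image[OF h hB[unfolded B_def]] by (simp add: B_def)
  also have "\<dots> = ennreal ((ua - la) * (ub - lb))"
    unfolding B_def using le'
    by (subst emeasure_lborel_box)
      (auto simp: Basis_vec_def inner_axis prod.UNION_disjoint axis_eq_axis UNIV_2)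
  also have "\<dots> = ennreal (\<Prod>b\<in>Basis. ((ua, ub) - (la, lb)) \<bullet> b)"
    by (simp add: Basis_prod_def mult.commute)
  finally show "emeasure (distr lborel borel (\<lambda>x. (x \<bullet> dir \<phi>, x \<bullet> dir (\<phi> + pi / 2)))) (box (la, lb) (ua, ub))
      = ennreal (\<Prod>b\<in>Basis. ((ua, ub) - (la, lb)) \<bullet> b)" by (simp add: T_def)
qed simp

lemma nn_integral_orthogonal_product:
  fixes f g :: "real \<Rightarrow> ennreal"
  assumes [measurable]: "f \<in> borel_measurable borel" "g \<in> borel_measurable borel"
  shows "(\<integral>\<^sup>+x. f (x \<bullet> dir \<phi>) * g (x \<bullet> dir (\<phi> + pi / 2)) \<partial>lborel)
      = (\<integral>\<^sup>+a. f a \<partial>lborel) * (\<integral>\<^sup>+y. g y \<partial>lborel)"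
proof -
  have m: "(\<lambda>p::real\<times>real. f (fst p) * g (snd p)) \<in> borel_measurable borel"
    unfolding borel_prod[symmetric] by measurable
  have "(\<lambda>x::real^2. (x \<bullet> dir \<phi>, x \<bullet> dir (\<phi> + pi / 2))) \<in> borel_measurable borel"
    by (intro borel_measurable_continuous_onI continuous_intros)
  then have T: "(\<lambda>x::real^2. (x \<bullet> dir \<phi>, x \<bullet> dir (\<phi> + pi / 2))) \<in> borel_measurable lborel"
    by simp
  have "(\<integral>\<^sup>+x. f (x \<bullet> dir \<phi>) * g (x \<bullet> dir (\<phi> + pi / 2)) \<partial>lborel)
      = (\<integral>\<^sup>+p. f (fst p) * g (snd p) \<partial>distr lborel borel (\<lambda>x. (x \<bullet> dir \<phi>, x \<bullet> dir (\<phi> + pi / 2))))"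
    by (subst nn_integral_distr[OF T]) (simp_all add: m)
  also have "\<dots> = (\<integral>\<^sup>+p. f (fst p) * g (snd p) \<partial>(lborel \<Otimes>\<^sub>M lborel))"
    by (simp add: lborel_distr_orthogonal_coordinates lborel_prod)
  also have "\<dots> = (\<integral>\<^sup>+a. \<integral>\<^sup>+y. f a * g y \<partial>lborel \<partial>lborel)"
    by (subst lborel.nn_integral_fst[symmetric]) simp_all
  also have "\<dots> = (\<integral>\<^sup>+a. f a \<partial>lborel) * (\<integral>\<^sup>+y. g y \<partial>lborel)"
    by (simp add: nn_integral_cmult nn_integral_multc)
  finally show ?thesis .
qed

section \<open>Power integrals on intervals and discs\<close>

lemma nn_integral_powr_reflected:
  fixes \<beta> :: real
  assumes \<beta>: "\<beta> < 1" and pq: "p \<le> q" "q \<le> R"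
  shows "(\<integral>\<^sup>+t. ennreal ((R - t) powr (- \<beta>)) * indicator {p..<q} t \<partial>lborel)
      = ennreal (((R - p) powr (1 - \<beta>) - (R - q) powr (1 - \<beta>)) / (1 - \<beta>))"
proof -
  define F where "F t = - ((R - t) powr (1 - \<beta>) / (1 - \<beta>))" for t
  \<comment> \<open>For \<open>q = R\<close> the integrand may be singular at the end, so only
    continuity of \<open>F\<close> on the closed interval and its derivative inside are
    used.\<close>
  have "((\<lambda>t. (R - t) powr (- \<beta>)) has_integral (F q - F p)) {p..q}"
  proof (rule fundamental_theorem_of_calculus_interior[OF pq(1)])
    show "continuous_on {p..q} F" unfolding F_def
      using pq \<beta> by (intro continuous_intros continuous_on_powr') auto
    fix t assume t: "t \<in> {p<..<q}"
    have "((\<lambda>s. s powr (1 - \<beta>)) has_real_derivative (1 - \<beta>) * (R - t) powr (1 - \<beta> - 1)) (at (R - t))"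
      using t pq by (intro has_real_derivative_powr) auto
    moreover have "((\<lambda>t. R - t) has_real_derivative - 1) (at t)"
      by (auto intro!: derivative_eq_intros)
    ultimately have "((\<lambda>t. (R - t) powr (1 - \<beta>)) has_real_derivative
        (1 - \<beta>) * (R - t) powr (1 - \<beta> - 1) * - 1) (at t)"
      by (rule DERIV_chain2[where g = "\<lambda>t. R - t" and f = "\<lambda>s. s powr (1 - \<beta>)"])
    then have "((\<lambda>t. (R - t) powr (1 - \<beta>)) has_real_derivative - ((1 - \<beta>) * (R - t) powr (- \<beta>))) (at t)"
      by simp
    from DERIV_minus[OF DERIV_cdivide[OF this, of "1 - \<beta>"]]
    have "(F has_real_derivative (R - t) powr (- \<beta>)) (at t)" using \<beta> by (simp add: F_def[abs_def])
    then show "(F has_vector_derivative (R - t) powr (- \<beta>)) (at t)"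
      by (simp add: has_real_derivative_iff_has_vector_derivative)
  qed
  then have "(\<integral>\<^sup>+t. ennreal ((R - t) powr (- \<beta>)) * indicator {p..q} t \<partial>lborel) = ennreal (F q - F p)"
    by (intro nn_integral_has_integral_lebesgue') auto
  moreover have "(\<integral>\<^sup>+t. ennreal ((R - t) powr (- \<beta>)) * indicator {p..q} t \<partial>lborel)
      = (\<integral>\<^sup>+t. ennreal ((R - t) powr (- \<beta>)) * indicator {p..<q} t \<partial>lborel)"
  proof (rule nn_integral_cong_AE)
    show "AE t in lborel. ennreal ((R - t) powr (- \<beta>)) * indicator {p..q} t
        = ennreal ((R - t) powr (- \<beta>)) * indicator {p..<q} t"
      using AE_lborel_singleton[of q] by eventually_elim (auto simp: indicator_def)
  qed
  moreover have "F q - F p = ((R - p) powr (1 - \<beta>) - (R - q) powr (1 - \<beta>)) / (1 - \<beta>)"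
    by (simp add: F_def diff_divide_distrib)
  ultimately show ?thesis by simp
qed

text \<open>The disc of radius \<open>sqrt t\<close> has area \<open>pi * t\<close>, so the squared
  norm has constant density \<open>pi\<close>. This takes the place of polar coordinates.\<close>

lemma distr_norm_sq:
  "distr lborel borel (\<lambda>x::real^2. (norm x)\<^sup>2) = density lborel (\<lambda>t. ennreal pi * indicator {0..} t)"
  (is "?L = ?R")
proof (rule measure_eqI_generator_eq[where E = "range atMost" and \<Omega> = UNIV and A = "\<lambda>i. {..real i}"])
  have m: "(\<lambda>x::real^2. (norm x)\<^sup>2) \<in> borel_measurable borel"
    by (intro borel_measurable_continuous_onI continuous_intros)
  have L: "emeasure ?L {..t} = ennreal (if t \<ge> 0 then pi * t else 0)" for t
  proof (cases "t \<ge> 0")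
    case True
    have "emeasure ?L {..t} = emeasure lborel {x::real^2. (norm x)\<^sup>2 \<le> t}"
      using m by (simp add: emeasure_distr vimage_def)
    also have "{x::real^2. (norm x)\<^sup>2 \<le> t} = cball 0 (sqrt t)"
    proof -
      have "(norm x)\<^sup>2 \<le> t \<longleftrightarrow> norm x \<le> sqrt t" for x :: "real ^ 2"
        by (metis abs_norm_cancel real_sqrt_abs real_sqrt_le_iff)
      then show ?thesis by (intro set_eqI) (simp only: mem_Collect_eq mem_cball_0)
    qed
    also have "emeasure lborel (cball (0 :: real^2) (sqrt t)) = ennreal (pi * t)"
      using True by (subst emeasure_cball) (simp_all add: eval_unit_ball_vol)
    finally show ?thesis using True by simp
  next
    case False
    then have "{x::real^2. (norm x)\<^sup>2 \<le> t} = {}"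
      by (auto simp: not_le intro: less_le_trans[OF _ zero_le_power2])
    then show ?thesis using m False by (simp add: emeasure_distr vimage_def)
  qed
  have R: "emeasure ?R {..t} = ennreal (if t \<ge> 0 then pi * t else 0)" for t :: real
  proof -
    have "emeasure ?R {..t} = (\<integral>\<^sup>+s. ennreal pi * indicator ({0..t}) s \<partial>lborel)"
      by (subst emeasure_density) (auto intro!: nn_integral_cong simp: indicator_def)
    also have "\<dots> = ennreal pi * emeasure lborel {0..t}"
      by (rule nn_integral_cmult_indicator) simp
    also have "\<dots> = ennreal (if t \<ge> 0 then pi * t else 0)"
      by (simp add: ennreal_mult)
    finally show ?thesis .
  qed
  show "emeasure ?L X = emeasure ?R X" if "X \<in> range atMost" for X using that L R by auto
  show "emeasure ?L {..real i} \<noteq> \<infinity>" for i by (simp only: L) simp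
  show "Int_stable (range (atMost :: real \<Rightarrow> _))" by (auto simp: Int_stable_def)
  show "sets ?L = sigma_sets UNIV (range atMost)" "sets ?R = sigma_sets UNIV (range atMost)"
    by (simp_all add: borel_eq_atMost)
  show "(\<Union>i. {..real i}) = UNIV" by (auto simp: real_arch_simple)
qed auto

lemma nn_integral_radial:
  assumes [measurable]: "f \<in> borel_measurable borel"
  shows "(\<integral>\<^sup>+(x::real^2). f ((norm x)\<^sup>2) \<partial>lborel) = ennreal pi * (\<integral>\<^sup>+t. f t * indicator {0..} t \<partial>lborel)"
proof -
  have "(\<lambda>x::real^2. (norm x)\<^sup>2) \<in> borel_measurable borel"
    by (intro borel_measurable_continuous_onI continuous_intros)
  then have m: "(\<lambda>x::real^2. (norm x)\<^sup>2) \<in> borel_measurable lborel"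
    by simp
  have "(\<integral>\<^sup>+(x::real^2). f ((norm x)\<^sup>2) \<partial>lborel) = (\<integral>\<^sup>+t. f t \<partial>distr lborel borel (\<lambda>x::real^2. (norm x)\<^sup>2))"
    by (rule nn_integral_distr[OF m, symmetric]) simp
  also have "\<dots> = (\<integral>\<^sup>+t. ennreal pi * indicator {0..} t * f t \<partial>lborel)"
    unfolding distr_norm_sq by (rule nn_integral_density) simp_all
  also have "\<dots> = ennreal pi * (\<integral>\<^sup>+t. f t * indicator {0..} t \<partial>lborel)"
    by (subst nn_integral_cmult[symmetric]) (simp_all add: mult_ac)
  finally show ?thesis .
qed

text \<open>Two radii, because both the barrier singular at radius \<open>c\<close> and the one
  singular at radius 1 are integrated over the disc of radius \<open>c\<close>.\<close>

lemma nn_integral_disc_powr: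
  fixes \<beta> \<rho> R :: real
  assumes \<beta>: "\<beta> < 1" and \<rho>: "0 \<le> \<rho>" "\<rho> \<le> R"
  shows "(\<integral>\<^sup>+(x::real^2). ennreal ((R\<^sup>2 - (norm x)\<^sup>2) powr (- \<beta>)) * indicator (ball 0 \<rho>) x \<partial>lborel)
      = ennreal (pi * (((R\<^sup>2) powr (1 - \<beta>) - (R\<^sup>2 - \<rho>\<^sup>2) powr (1 - \<beta>)) / (1 - \<beta>)))"
proof -
  have i: "indicator (ball 0 \<rho>) x = (indicator {0..<\<rho>\<^sup>2} ((norm x)\<^sup>2) :: ennreal)" for x :: "real^2"
    using \<rho> power_strict_mono[of "norm x" \<rho> 2] power2_less_imp_less[of "norm x" \<rho>]
    by (auto simp: indicator_def)
  have sq: "\<rho>\<^sup>2 \<le> R\<^sup>2" using \<rho> by (intro power_mono)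
  have "(\<integral>\<^sup>+(x::real^2). ennreal ((R\<^sup>2 - (norm x)\<^sup>2) powr (- \<beta>)) * indicator (ball 0 \<rho>) x \<partial>lborel)
    = ennreal pi * (\<integral>\<^sup>+t. (ennreal ((R\<^sup>2 - t) powr (- \<beta>)) * indicator {0..<\<rho>\<^sup>2} t) * indicator {0..} t \<partial>lborel)"
    unfolding i
    by (rule nn_integral_radial[where f = "\<lambda>t. ennreal ((R\<^sup>2 - t) powr (- \<beta>)) * indicator {0..<\<rho>\<^sup>2} t"]) measurable
  also have "(\<integral>\<^sup>+t. (ennreal ((R\<^sup>2 - t) powr (- \<beta>)) * indicator {0..<\<rho>\<^sup>2} t) * indicator {0..} t \<partial>lborel)
    = (\<integral>\<^sup>+t. ennreal ((R\<^sup>2 - t) powr (- \<beta>)) * indicator {0..<\<rho>\<^sup>2} t \<partial>lborel)"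
    by (intro nn_integral_cong) (auto simp: indicator_def)
  also have "\<dots> = ennreal (((R\<^sup>2 - 0) powr (1 - \<beta>) - (R\<^sup>2 - \<rho>\<^sup>2) powr (1 - \<beta>)) / (1 - \<beta>))"
    by (rule nn_integral_powr_reflected[OF \<beta> _ sq]) simp
  also have "ennreal pi * \<dots> = ennreal (pi * (((R\<^sup>2) powr (1 - \<beta>) - (R\<^sup>2 - \<rho>\<^sup>2) powr (1 - \<beta>)) / (1 - \<beta>)))"
    using \<beta> sq by (subst ennreal_mult[symmetric]) (auto intro!: divide_nonneg_nonneg powr_mono2)
  finally show ?thesis .
qed

lemma nn_integral_powr_symmetric_le:
  fixes \<beta> :: real
  assumes \<beta>: "\<beta> < 1" and s: "s > 0"
  shows "(\<integral>\<^sup>+y. ennreal ((s - \<bar>y\<bar>) powr (- \<beta>)) * indicator {-s<..<s} y \<partial>lborel)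
      \<le> ennreal (2 * (s powr (1 - \<beta>) / (1 - \<beta>)))"
proof -
  define f where "f y = ennreal ((s - y) powr (- \<beta>)) * indicator {0..<s} y" for y
  have [measurable]: "f \<in> borel_measurable borel" unfolding f_def by measurable
  have f: "(\<integral>\<^sup>+y. f y \<partial>lborel) = ennreal (s powr (1 - \<beta>) / (1 - \<beta>))"
    unfolding f_def using nn_integral_powr_reflected[OF \<beta>, of 0 s s] s by simp
  have f': "(\<integral>\<^sup>+y. f (- y) \<partial>lborel) = (\<integral>\<^sup>+y. f y \<partial>lborel)"
    using nn_integral_real_affine[of f "-1" 0] by simp
  \<comment> \<open>Only an inequality pointwise: at \<open>y = 0\<close> both summands
    contribute.\<close>
  have "(\<integral>\<^sup>+y. ennreal ((s - \<bar>y\<bar>) powr (- \<beta>)) * indicator {-s<..<s} y \<partial>lborel)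
      \<le> (\<integral>\<^sup>+y. f y + f (- y) \<partial>lborel)"
    by (rule nn_integral_mono) (auto simp: f_def indicator_def)
  also have "\<dots> = (\<integral>\<^sup>+y. f y \<partial>lborel) + (\<integral>\<^sup>+y. f (- y) \<partial>lborel)"
    by (rule nn_integral_add) measurable
  also have "\<dots> = ennreal (2 * (s powr (1 - \<beta>) / (1 - \<beta>)))"
    unfolding f' f using \<beta> by (subst ennreal_plus[symmetric]) auto
  finally show ?thesis .
qed

subsection \<open>Integrating the barriers\<close>

context polygon
begin

lemma \<Omega>_open_bounded: "open \<Omega>" "bounded \<Omega>"
  using \<Omega>_subset_ball bounded_ball bounded_subset by (auto intro: bounded_subset)

text \<open>The barrier at \<open>x\<close> uses a parameter \<open>s\<close> that depends on
  \<open>x\<close>, so one null set must serve all \<open>s\<close>. Rational \<open>s\<close> need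
  countably many null sets, and the bound is continuous in \<open>s\<close>.\<close>

lemma AE_lower_bound_all_balls:
  assumes u: "u \<in> W12_0 \<Omega>" "weak_laplacian \<Omega> u (\<lambda>_. -1)"
  shows "AE x in lebesgue. x \<in> \<Omega> \<longrightarrow> (\<forall>j s. 0 \<le> s \<longrightarrow> s < 1 \<longrightarrow>
      (((1 - s) * c)\<^sup>2 - (norm (x - s *\<^sub>R vertex j))\<^sup>2) / 4 \<le> u x)"
proof -
  define q where "q x j s = (((1 - s) * c)\<^sup>2 - (norm (x - s *\<^sub>R vertex j))\<^sup>2) / 4" for x j s
  have "AE x in lebesgue. \<forall>j. \<forall>s\<in>\<rat> \<inter> {0..<1}. x \<in> \<Omega> \<longrightarrow> q x j s \<le> u x"
    unfolding AE_all_countable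
  proof (intro allI)
    fix j
    show "AE x in lebesgue. \<forall>s\<in>\<rat> \<inter> {0..<1}. x \<in> \<Omega> \<longrightarrow> q x j s \<le> u x"
    proof (subst AE_ball_countable)
      show "countable (\<rat> \<inter> {0..<1::real})" using countable_rat by blast
      show "\<forall>s\<in>\<rat> \<inter> {0..<1}. AE x in lebesgue. x \<in> \<Omega> \<longrightarrow> q x j s \<le> u x"
        unfolding q_def using c_ge ball_subset_\<Omega>
        by (intro ballI solution_lower_bound_ball[OF \<Omega>_open_bounded u]) auto
    qed
  qed
  then show ?thesis
  proof eventually_elim
    fix x assume *: "\<forall>j. \<forall>s\<in>\<rat> \<inter> {0..<1}. x \<in> \<Omega> \<longrightarrow> q x j s \<le> u x"
    have "q x j s \<le> u x" if x: "x \<in> \<Omega>" and s: "0 \<le> s" "s < 1" for j s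
    proof (rule ccontr)
      assume "\<not> q x j s \<le> u x"
      \<comment> \<open>Approach from the right, so that the rationals stay in
        \<open>{0..<1}\<close> also for \<open>s = 0\<close>.\<close>
      moreover have "(q x j \<longlongrightarrow> q x j s) (at_right s)"
        unfolding q_def by (intro tendsto_intros) auto
      ultimately have "eventually (\<lambda>r. u x < q x j r) (at_right s)"
        by (intro order_tendstoD(1)) auto
      then obtain b where b: "b > s" "\<And>r. s < r \<Longrightarrow> r < b \<Longrightarrow> u x < q x j r"
        by (auto simp: eventually_at_right_field)
      obtain r where r: "r \<in> \<rat>" "s < r" "r < min b 1"
        using Rats_dense_in_real[of s "min b 1"] b(1) s by auto
      then have "q x j r \<le> u x" using * x s by auto
      then show False using b(2)[of r] r by auto
    qed
    then show "x \<in> \<Omega> \<longrightarrow> (\<forall>j s. 0 \<le> s \<longrightarrow> s < 1 \<longrightarrow>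
      (((1 - s) * c)\<^sup>2 - (norm (x - s *\<^sub>R vertex j))\<^sup>2) / 4 \<le> u x)" by (simp add: q_def)
  qed
qed

text \<open>The \<open>-\<beta>\<close> power of the bound of \<open>lower_bound_in_sector\<close>, cut off to the rectangle at side \<open>k\<close> that
  contains the part of the polygon outside the incircle.\<close>

definition side_bound :: "real \<Rightarrow> nat \<Rightarrow> real ^ 2 \<Rightarrow> ennreal" where
  "side_bound \<beta> k x = ennreal ((4 * \<sigma> / c) powr \<beta>) *
     ((ennreal ((c - x \<bullet> dir (mid k)) powr (- \<beta>)) * indicator {c - \<sigma>\<^sup>2 / c..<c} (x \<bullet> dir (mid k))) *
     (ennreal ((\<sigma> - \<bar>x \<bullet> dir (mid k + pi / 2)\<bar>) powr (- \<beta>))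
        * indicator {- \<sigma><..<\<sigma>} (x \<bullet> dir (mid k + pi / 2))))"

lemma nn_integral_side_bound:
  assumes \<beta>: "0 < \<beta>" "\<beta> < 1"
  shows "(\<integral>\<^sup>+x. side_bound \<beta> k x \<partial>lborel) \<le> ennreal ((4 * \<sigma> / c) powr \<beta> *
      ((\<sigma>\<^sup>2 / c) powr (1 - \<beta>) / (1 - \<beta>) * (2 * (\<sigma> powr (1 - \<beta>) / (1 - \<beta>)))))"
proof -
  define f where "f a = ennreal ((c - a) powr (- \<beta>)) * indicator {c - \<sigma>\<^sup>2 / c..<c} a" for a
  define g where "g y = ennreal ((\<sigma> - \<bar>y\<bar>) powr (- \<beta>)) * indicator {- \<sigma><..<\<sigma>} y" for y
  have [measurable]: "f \<in> borel_measurable borel" "g \<in> borel_measurable borel"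
    unfolding f_def g_def by measurable
  have c0: "c > 0" using c_ge by simp
  have f: "(\<integral>\<^sup>+a. f a \<partial>lborel) = ennreal ((\<sigma>\<^sup>2 / c) powr (1 - \<beta>) / (1 - \<beta>))"
    unfolding f_def using c0 nn_integral_powr_reflected[OF \<beta>(2), of "c - \<sigma>\<^sup>2 / c" c c] by simp
  have g: "(\<integral>\<^sup>+y. g y \<partial>lborel) \<le> ennreal (2 * (\<sigma> powr (1 - \<beta>) / (1 - \<beta>)))"
    unfolding g_def by (rule nn_integral_powr_symmetric_le[OF \<beta>(2) \<sigma>_pos])
  have "(\<integral>\<^sup>+x. side_bound \<beta> k x \<partial>lborel)
      = ennreal ((4 * \<sigma> / c) powr \<beta>) * (\<integral>\<^sup>+x. f (x \<bullet> dir (mid k)) * g (x \<bullet> dir (mid k + pi / 2)) \<partial>lborel)"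
    unfolding side_bound_def f_def[symmetric] g_def[symmetric] by (rule nn_integral_cmult) measurable
  also have "\<dots> = ennreal ((4 * \<sigma> / c) powr \<beta>) * ((\<integral>\<^sup>+a. f a \<partial>lborel) * (\<integral>\<^sup>+y. g y \<partial>lborel))"
    by (subst nn_integral_orthogonal_product) simp_all
  also have "\<dots> \<le> ennreal ((4 * \<sigma> / c) powr \<beta>) * (ennreal ((\<sigma>\<^sup>2 / c) powr (1 - \<beta>) / (1 - \<beta>))
      * ennreal (2 * (\<sigma> powr (1 - \<beta>) / (1 - \<beta>))))"
    unfolding f by (intro mult_left_mono g) auto
  also have "\<dots> = ennreal ((4 * \<sigma> / c) powr \<beta> *
      ((\<sigma>\<^sup>2 / c) powr (1 - \<beta>) / (1 - \<beta>) * (2 * (\<sigma> powr (1 - \<beta>) / (1 - \<beta>)))))"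
  proof -
    have "ennreal p * (ennreal q * ennreal r) = ennreal (p * (q * r))"
      if "p \<ge> 0" "q \<ge> 0" "r \<ge> 0" for p q r :: real
      using that by (simp add: ennreal_mult)
    then show ?thesis using \<beta> by simp
  qed
  finally show ?thesis .
qed

text \<open>Inside the incircle the parameter \<open>s = 0\<close> suffices. Outside, only the
  summand of the nearest side is needed; adding the other, nonnegative ones avoids a partition into
  sectors.\<close>

lemma pointwise_upper_bound:
  assumes \<beta>: "0 < \<beta>" "\<beta> < 1" and x: "x \<in> \<Omega>"
    and lower: "\<And>j s. 0 \<le> s \<Longrightarrow> s < 1 \<Longrightarrow>
      (((1 - s) * c)\<^sup>2 - (norm (x - s *\<^sub>R vertex j))\<^sup>2) / 4 \<le> v"
  shows "ennreal (v powr (- \<beta>)) \<le> ennreal (4 powr \<beta>) *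
      (ennreal ((c\<^sup>2 - (norm x)\<^sup>2) powr (- \<beta>)) * indicator (ball 0 c) x) + (\<Sum>k<N. side_bound \<beta> k x)"
proof (cases "norm x < c")
  case True
  then have "(norm x)\<^sup>2 < c\<^sup>2" by (intro power_strict_mono) auto
  then have "v powr (- \<beta>) \<le> ((c\<^sup>2 - (norm x)\<^sup>2) / 4) powr (- \<beta>)"
    using \<beta> lower[of 0 0] by (intro powr_mono2') auto
  also have "\<dots> = 4 powr \<beta> * (c\<^sup>2 - (norm x)\<^sup>2) powr (- \<beta>)"
    using \<open>(norm x)\<^sup>2 < c\<^sup>2\<close> by (simp add: powr_divide powr_minus_divide)
  finally have "ennreal (v powr (- \<beta>)) \<le> ennreal (4 powr \<beta>) * (ennreal ((c\<^sup>2 - (norm x)\<^sup>2) powr (- \<beta>)) * indicator (ball 0 c) x)"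
    using True by (simp add: ennreal_mult[symmetric] ennreal_leI)
  then show ?thesis by (rule add_increasing2[rotated]) (simp add: sum_nonneg)
next
  case False
  obtain k where k: "k < N" "x \<bullet> dir (mid k) < c" "\<bar>x \<bullet> dir (mid k + pi / 2)\<bar> < \<sigma>"
    "(norm x)\<^sup>2 = (x \<bullet> dir (mid k))\<^sup>2 + (x \<bullet> dir (mid k + pi / 2))\<^sup>2" "0 \<le> x \<bullet> dir (mid k)"
    "\<exists>s j. 0 \<le> s \<and> s < 1 \<and> c / 4 * ((c - x \<bullet> dir (mid k)) * (1 - \<bar>x \<bullet> dir (mid k + pi / 2)\<bar> / \<sigma>))
        \<le> (((1 - s) * c)\<^sup>2 - (norm (x - s *\<^sub>R vertex j))\<^sup>2) / 4"
    by (rule lower_bound_in_sector[OF x])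
  define a y where "a = x \<bullet> dir (mid k)" and "y = x \<bullet> dir (mid k + pi / 2)"
  note k = k[folded a_def y_def]
  have c0: "c > 0" using c_ge by simp
  have v: "c / 4 * ((c - a) * (1 - \<bar>y\<bar> / \<sigma>)) \<le> v"
    using k(6) lower by (meson order_trans)
  \<comment> \<open>Origin of the prefactor \<open>(4 * \<sigma> / c) powr \<beta>\<close> in
    \<open>side_bound\<close>.\<close>
  have e: "c / 4 * ((c - a) * (1 - \<bar>y\<bar> / \<sigma>)) = (c - a) * (\<sigma> - \<bar>y\<bar>) / (4 * \<sigma> / c)"
    using \<sigma>_pos c0 by (simp add: field_simps)
  have pos: "0 < (c - a) * (\<sigma> - \<bar>y\<bar>) / (4 * \<sigma> / c)"
    using \<sigma>_pos c0 k by (intro divide_pos_pos mult_pos_pos) auto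
  \<comment> \<open>Origin of the rectangle's height: outside the incircle
    \<open>(c - a) * (c + a) \<le> \<sigma>^2\<close>, and \<open>c + a \<ge> c\<close>.\<close>
  have "c\<^sup>2 \<le> (norm x)\<^sup>2" using False c0 by (intro power_mono) auto
  also have "\<dots> \<le> a\<^sup>2 + \<sigma>\<^sup>2"
    unfolding k(4) using k(3) power_mono[of "\<bar>y\<bar>" \<sigma> 2] by simp
  finally have "(c - a) * (c + a) \<le> \<sigma>\<^sup>2" by (simp add: power2_eq_square algebra_simps)
  moreover have "(c - a) * c \<le> (c - a) * (c + a)" using k by (intro mult_left_mono) auto
  ultimately have "c - a \<le> \<sigma>\<^sup>2 / c" using c0 by (simp add: pos_le_divide_eq)
  then have ind: "a \<in> {c - \<sigma>\<^sup>2 / c..<c}" "y \<in> {- \<sigma><..<\<sigma>}" using k by auto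
  have "v powr (- \<beta>) \<le> ((c - a) * (\<sigma> - \<bar>y\<bar>) / (4 * \<sigma> / c)) powr (- \<beta>)"
    using v pos \<beta> unfolding e by (intro powr_mono2') auto
  also have "\<dots> = (4 * \<sigma> / c) powr \<beta> * ((c - a) powr (- \<beta>) * (\<sigma> - \<bar>y\<bar>) powr (- \<beta>))"
    using k \<sigma>_pos c0 by (subst powr_divide) (auto simp: powr_mult powr_minus_divide)
  finally have "ennreal (v powr (- \<beta>)) \<le> side_bound \<beta> k x"
    unfolding side_bound_def a_def[symmetric] y_def[symmetric]
    using ind by (simp add: ennreal_mult[symmetric] ennreal_leI)
  also have "\<dots> \<le> (\<Sum>k<N. side_bound \<beta> k x)"
    using k(1) by (intro member_le_sum) auto
  finally show ?thesis by (rule add_increasing[rotated]) simp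
qed

lemma borel_measurable_side_bound: "side_bound \<beta> k \<in> borel_measurable borel"
  unfolding side_bound_def[abs_def] by measurable

lemma nn_integral_upper_bound:
  assumes u: "u \<in> W12_0 \<Omega>" "weak_laplacian \<Omega> u (\<lambda>_. -1)" and \<beta>: "0 < \<beta>" "\<beta> < 1"
  shows "(\<integral>\<^sup>+x. ennreal (u x powr (- \<beta>)) * indicator \<Omega> x \<partial>lebesgue)
    \<le> ennreal (4 powr \<beta> * pi / (1 - \<beta>) + real N * ((4 * \<sigma> / c) powr \<beta> *
      ((\<sigma>\<^sup>2 / c) powr (1 - \<beta>) / (1 - \<beta>) * (2 * (\<sigma> powr (1 - \<beta>) / (1 - \<beta>))))))"
proof -
  define b where "b = (4 * \<sigma> / c) powr \<beta> *
      ((\<sigma>\<^sup>2 / c) powr (1 - \<beta>) / (1 - \<beta>) * (2 * (\<sigma> powr (1 - \<beta>) / (1 - \<beta>))))"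
  have b0: "b \<ge> 0" using \<beta> by (simp add: b_def)
  define d where "d x = ennreal ((c\<^sup>2 - (norm x)\<^sup>2) powr (- \<beta>)) * indicator (ball 0 c) x" for x :: "real^2"
  have [measurable]: "ball (0 :: real^2) c \<in> sets borel" by simp
  have [measurable]: "d \<in> borel_measurable borel" unfolding d_def by measurable
  note borel_measurable_side_bound[measurable]
  have "(\<integral>\<^sup>+x. ennreal (u x powr (- \<beta>)) * indicator \<Omega> x \<partial>lebesgue)
      \<le> (\<integral>\<^sup>+x. ennreal (4 powr \<beta>) * d x + (\<Sum>k<N. side_bound \<beta> k x) \<partial>lebesgue)"
    using AE_lower_bound_all_balls[OF u]
  proof (intro nn_integral_mono_AE, eventually_elim)
    fix x assume *: "x \<in> \<Omega> \<longrightarrow> (\<forall>j s. 0 \<le> s \<longrightarrow> s < 1 \<longrightarrow>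
      (((1 - s) * c)\<^sup>2 - (norm (x - s *\<^sub>R vertex j))\<^sup>2) / 4 \<le> u x)"
    show "ennreal (u x powr (- \<beta>)) * indicator \<Omega> x \<le> ennreal (4 powr \<beta>) * d x + (\<Sum>k<N. side_bound \<beta> k x)"
    proof (cases "x \<in> \<Omega>")
      case True
      then show ?thesis using pointwise_upper_bound[OF \<beta> True, of "u x"] * by (simp add: d_def)
    qed simp
  qed
  also have "\<dots> = (\<integral>\<^sup>+x. ennreal (4 powr \<beta>) * d x + (\<Sum>k<N. side_bound \<beta> k x) \<partial>lborel)"
    by (simp add: nn_integral_completion)
  also have "\<dots> = ennreal (4 powr \<beta>) * (\<integral>\<^sup>+x. d x \<partial>lborel) + (\<Sum>k<N. \<integral>\<^sup>+x. side_bound \<beta> k x \<partial>lborel)"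
    by (simp add: nn_integral_add nn_integral_sum nn_integral_cmult)
  also have "\<dots> \<le> ennreal (4 powr \<beta> * pi / (1 - \<beta>)) + (\<Sum>k<N. ennreal b)"
  proof (intro add_mono sum_mono)
    have c01: "0 \<le> c" "c\<^sup>2 \<le> 1" using c_ge c_lt_1 by (simp_all add: power_le_one)
    have "(\<integral>\<^sup>+x. d x \<partial>lborel) = ennreal (pi * ((c\<^sup>2) powr (1 - \<beta>) / (1 - \<beta>)))"
      unfolding d_def using nn_integral_disc_powr[OF \<beta>(2), of c c] c01 by simp
    also have "\<dots> \<le> ennreal (pi * (1 / (1 - \<beta>)))"
      using \<beta> c01 powr_mono2[of "1 - \<beta>" "c\<^sup>2" 1]
      by (intro ennreal_leI mult_left_mono divide_right_mono) auto
    finally have "ennreal (4 powr \<beta>) * (\<integral>\<^sup>+x. d x \<partial>lborel) \<le> ennreal (4 powr \<beta>) * ennreal (pi * (1 / (1 - \<beta>)))"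
      by (intro mult_left_mono) auto
    then show "ennreal (4 powr \<beta>) * (\<integral>\<^sup>+x. d x \<partial>lborel) \<le> ennreal (4 powr \<beta> * pi / (1 - \<beta>))"
      using \<beta> by (simp add: ennreal_mult[symmetric])
    show "(\<integral>\<^sup>+x. side_bound \<beta> k x \<partial>lborel) \<le> ennreal b" for k
      unfolding b_def by (rule nn_integral_side_bound[OF \<beta>])
  qed
  also have "\<dots> = ennreal (4 powr \<beta> * pi / (1 - \<beta>) + real N * b)"
  proof -
    have "(\<Sum>k<N. ennreal b) = ennreal (real N * b)"
      using b0 by (simp add: ennreal_of_nat_eq_real_of_nat ennreal_mult)
    then show ?thesis using \<beta> b0 by (simp only:) (rule ennreal_plus[symmetric], auto)
  qed
  finally show ?thesis by (simp only: b_def)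
qed

text \<open>Only the disc inside the incircle is kept. Integrating the unit-disc barrier there loses
  the term \<open>(1 - c^2) powr (1 - \<beta>)\<close>, and
  \<open>1 - c^2 = \<sigma>^2\<close>.\<close>

lemma nn_integral_lower_bound:
  assumes u: "u \<in> W12_0 \<Omega>" "weak_laplacian \<Omega> u (\<lambda>_. -1)" and \<beta>: "0 < \<beta>" "\<beta> < 1"
  shows "ennreal (4 powr \<beta> * pi / (1 - \<beta>) * (1 - (\<sigma>\<^sup>2) powr (1 - \<beta>)))
    \<le> (\<integral>\<^sup>+x. ennreal (u x powr (- \<beta>)) * indicator \<Omega> x \<partial>lebesgue)"
proof -
  define d where "d x = ennreal ((1 - (norm x)\<^sup>2) powr (- \<beta>)) * indicator (ball 0 c) x" for x :: "real^2"
  have [measurable]: "ball (0 :: real^2) c \<in> sets borel" by simp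
  have [measurable]: "d \<in> borel_measurable borel" unfolding d_def by measurable
  have c01: "0 \<le> c" "c \<le> 1" using c_ge c_lt_1 by simp_all
  have s: "1 - c\<^sup>2 = \<sigma>\<^sup>2" using c_\<sigma> by simp
  have "(\<integral>\<^sup>+x. d x \<partial>lborel) = ennreal (pi * ((1 - (\<sigma>\<^sup>2) powr (1 - \<beta>)) / (1 - \<beta>)))"
    unfolding d_def using nn_integral_disc_powr[OF \<beta>(2) c01] by (simp add: s)
  then have "ennreal (4 powr \<beta> * pi / (1 - \<beta>) * (1 - (\<sigma>\<^sup>2) powr (1 - \<beta>)))
      = ennreal (4 powr \<beta>) * (\<integral>\<^sup>+x. d x \<partial>lborel)"
    by (simp add: ennreal_mult'[symmetric] mult_ac)
  also have "\<dots> = (\<integral>\<^sup>+x. ennreal (4 powr \<beta>) * d x \<partial>lebesgue)"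
    by (simp add: nn_integral_completion nn_integral_cmult)
  also have "\<dots> \<le> (\<integral>\<^sup>+x. ennreal (u x powr (- \<beta>)) * indicator \<Omega> x \<partial>lebesgue)"
    using AE_lower_bound_all_balls[OF u] solution_upper_bound[OF \<Omega>_open_bounded(1) \<Omega>_subset_ball u]
  proof (intro nn_integral_mono_AE, eventually_elim)
    fix x assume *: "x \<in> \<Omega> \<longrightarrow> (\<forall>j s. 0 \<le> s \<longrightarrow> s < 1 \<longrightarrow>
      (((1 - s) * c)\<^sup>2 - (norm (x - s *\<^sub>R vertex j))\<^sup>2) / 4 \<le> u x)"
      and up: "x \<in> \<Omega> \<longrightarrow> u x \<le> (1 - (norm x)\<^sup>2) / 4"
    show "ennreal (4 powr \<beta>) * d x \<le> ennreal (u x powr (- \<beta>)) * indicator \<Omega> x"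
    proof (cases "norm x < c")
      case True
      then have x: "x \<in> \<Omega>" using ball_subset_\<Omega>[of 0 0] by auto
      have "(norm x)\<^sup>2 < c\<^sup>2" using True by (intro power_strict_mono) auto
      moreover have "(c\<^sup>2 - (norm x)\<^sup>2) / 4 \<le> u x" using *[rule_format, OF x, of 0 0] by simp
      \<comment> \<open>Positivity is essential: \<open>0 powr (- \<beta>)\<close> is 0, so the
        power is decreasing only for positive bases.\<close>
      ultimately have "u x > 0" by simp
      then have le: "((1 - (norm x)\<^sup>2) / 4) powr (- \<beta>) \<le> u x powr (- \<beta>)"
        using up x \<beta> by (intro powr_mono2') auto
      have "(norm x)\<^sup>2 \<le> 1" using True c01 by (simp add: power_le_one)
      then have "((1 - (norm x)\<^sup>2) / 4) powr (- \<beta>) = 4 powr \<beta> * (1 - (norm x)\<^sup>2) powr (- \<beta>)"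
        by (simp add: powr_divide powr_minus_divide)
      with le show ?thesis using True x by (simp add: d_def ennreal_mult[symmetric] ennreal_leI)
    qed (simp add: d_def)
  qed
  finally show ?thesis .
qed

text \<open>The weakening of \<open>\<sigma>^2 \<le> (pi / N)^2\<close> to \<open>pi^2 / N\<close>
  yields the exponent \<open>\<beta> - 1\<close>. The constants 8 and 2 come from
  \<open>1 / c \<le> 2\<close>.\<close>

lemma error_bounds:
  assumes \<beta>: "0 < \<beta>" "\<beta> < 1"
  shows "(\<sigma>\<^sup>2) powr (1 - \<beta>) \<le> (pi\<^sup>2) powr (1 - \<beta>) * real N powr (\<beta> - 1)"
    and "real N * ((4 * \<sigma> / c) powr \<beta> *
      ((\<sigma>\<^sup>2 / c) powr (1 - \<beta>) / (1 - \<beta>) * (2 * (\<sigma> powr (1 - \<beta>) / (1 - \<beta>)))))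
      \<le> 2 * pi * 8 powr \<beta> * 2 powr (1 - \<beta>) * (pi\<^sup>2) powr (1 - \<beta>) / (1 - \<beta>)\<^sup>2 * real N powr (\<beta> - 1)"
proof -
  have N0: "real N \<ge> 1" using N by simp
  have "\<sigma>\<^sup>2 \<le> (pi / N)\<^sup>2" using \<sigma>_pos \<sigma>_le by (intro power_mono) auto
  also have "\<dots> \<le> pi\<^sup>2 / N"
  proof -
    have "pi\<^sup>2 * real N \<le> pi\<^sup>2 * (real N)\<^sup>2" using N0 by (intro mult_left_mono self_le_power) auto
    then show ?thesis using N0 by (simp add: power_divide field_simps power2_eq_square)
  qed
  finally have "(\<sigma>\<^sup>2) powr (1 - \<beta>) \<le> (pi\<^sup>2 / N) powr (1 - \<beta>)"
    using \<beta> by (intro powr_mono2) auto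
  also have "\<dots> = (pi\<^sup>2) powr (1 - \<beta>) * real N powr (\<beta> - 1)"
    using powr_minus_divide[of "real N" "1 - \<beta>"] by (simp add: powr_divide)
  finally show 1: "(\<sigma>\<^sup>2) powr (1 - \<beta>) \<le> (pi\<^sup>2) powr (1 - \<beta>) * real N powr (\<beta> - 1)" .
  have c2: "1 / c \<le> 2" "c > 0" using c_ge by (auto simp: field_simps)
  have "4 * \<sigma> / c \<le> 8 * \<sigma>" using mult_left_mono[OF c2(1), of "4 * \<sigma>"] \<sigma>_pos by simp
  then have a: "(4 * \<sigma> / c) powr \<beta> \<le> 8 powr \<beta> * \<sigma> powr \<beta>"
    using \<beta> \<sigma>_pos c2 by (subst powr_mult[symmetric]) (auto intro!: powr_mono2)
  have "\<sigma>\<^sup>2 / c \<le> 2 * \<sigma>\<^sup>2" using mult_left_mono[OF c2(1), of "\<sigma>\<^sup>2"] by simp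
  then have b: "(\<sigma>\<^sup>2 / c) powr (1 - \<beta>) \<le> 2 powr (1 - \<beta>) * (\<sigma>\<^sup>2) powr (1 - \<beta>)"
    using \<beta> c2 by (subst powr_mult[symmetric]) (auto intro!: powr_mono2)
  have "(4 * \<sigma> / c) powr \<beta> * ((\<sigma>\<^sup>2 / c) powr (1 - \<beta>) / (1 - \<beta>) * (2 * (\<sigma> powr (1 - \<beta>) / (1 - \<beta>))))
    \<le> (8 powr \<beta> * \<sigma> powr \<beta>) * ((2 powr (1 - \<beta>) * (\<sigma>\<^sup>2) powr (1 - \<beta>)) / (1 - \<beta>) * (2 * (\<sigma> powr (1 - \<beta>) / (1 - \<beta>))))"
    using \<beta> a b by (intro mult_mono divide_right_mono order.refl) auto
  also have "\<dots> = (\<sigma> powr \<beta> * \<sigma> powr (1 - \<beta>)) * (2 * 8 powr \<beta> * 2 powr (1 - \<beta>) / (1 - \<beta>)\<^sup>2 * (\<sigma>\<^sup>2) powr (1 - \<beta>))"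
    by (simp add: power2_eq_square mult_ac)
  \<comment> \<open>This full power of \<open>\<sigma>\<close> absorbs the number of sides, through
    \<open>real N * \<sigma> \<le> pi\<close>.\<close>
  also have "\<sigma> powr \<beta> * \<sigma> powr (1 - \<beta>) = \<sigma>" using \<sigma>_pos by (simp add: powr_add[symmetric])
  finally have le: "(4 * \<sigma> / c) powr \<beta> * ((\<sigma>\<^sup>2 / c) powr (1 - \<beta>) / (1 - \<beta>) * (2 * (\<sigma> powr (1 - \<beta>) / (1 - \<beta>))))
    \<le> \<sigma> * (2 * 8 powr \<beta> * 2 powr (1 - \<beta>) / (1 - \<beta>)\<^sup>2 * (\<sigma>\<^sup>2) powr (1 - \<beta>))" .
  have "real N * ((4 * \<sigma> / c) powr \<beta> *
      ((\<sigma>\<^sup>2 / c) powr (1 - \<beta>) / (1 - \<beta>) * (2 * (\<sigma> powr (1 - \<beta>) / (1 - \<beta>)))))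
    \<le> (real N * \<sigma>) * (2 * 8 powr \<beta> * 2 powr (1 - \<beta>) / (1 - \<beta>)\<^sup>2 * (\<sigma>\<^sup>2) powr (1 - \<beta>))"
    using mult_left_mono[OF le, of "real N"] by (simp only: mult.assoc of_nat_0_le_iff)
  also have "\<dots> \<le> pi * (2 * 8 powr \<beta> * 2 powr (1 - \<beta>) / (1 - \<beta>)\<^sup>2 * ((pi\<^sup>2) powr (1 - \<beta>) * real N powr (\<beta> - 1)))"
  proof (intro mult_mono mult_left_mono 1)
    show "real N * \<sigma> \<le> pi" using \<sigma>_le N0 by (simp add: field_simps)
  qed auto
  finally show "real N * ((4 * \<sigma> / c) powr \<beta> *
      ((\<sigma>\<^sup>2 / c) powr (1 - \<beta>) / (1 - \<beta>) * (2 * (\<sigma> powr (1 - \<beta>) / (1 - \<beta>)))))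
      \<le> 2 * pi * 8 powr \<beta> * 2 powr (1 - \<beta>) * (pi\<^sup>2) powr (1 - \<beta>) / (1 - \<beta>)\<^sup>2 * real N powr (\<beta> - 1)"
    by (simp add: mult_ac)
qed

lemma integral_estimate:
  assumes u: "u \<in> W12_0 \<Omega>" "weak_laplacian \<Omega> u (\<lambda>_. -1)" and \<beta>: "0 < \<beta>" "\<beta> < 1"
  shows "set_integrable lebesgue \<Omega> (\<lambda>x. u x powr (- \<beta>))"
    and "\<bar>(LINT x:\<Omega>|lebesgue. u x powr (- \<beta>)) - 4 powr \<beta> * pi / (1 - \<beta>)\<bar>
      \<le> (4 powr \<beta> * pi / (1 - \<beta>) * (pi\<^sup>2) powr (1 - \<beta>)
          + 2 * pi * 8 powr \<beta> * 2 powr (1 - \<beta>) * (pi\<^sup>2) powr (1 - \<beta>) / (1 - \<beta>)\<^sup>2) * real N powr (\<beta> - 1)"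
proof -
  define J where "J = (\<integral>\<^sup>+x. ennreal (u x powr (- \<beta>)) * indicator \<Omega> x \<partial>lebesgue)"
  define A where "A = 4 powr \<beta> * pi / (1 - \<beta>)"
  define E where "E = real N * ((4 * \<sigma> / c) powr \<beta> *
      ((\<sigma>\<^sup>2 / c) powr (1 - \<beta>) / (1 - \<beta>) * (2 * (\<sigma> powr (1 - \<beta>) / (1 - \<beta>)))))"
  have A0: "A \<ge> 0" and E0: "E \<ge> 0" using \<beta> by (auto simp: A_def E_def)
  have up: "J \<le> ennreal (A + E)"
    unfolding J_def A_def E_def by (rule nn_integral_upper_bound[OF u \<beta>])
  have lo: "ennreal (A * (1 - (\<sigma>\<^sup>2) powr (1 - \<beta>))) \<le> J"
    unfolding J_def A_def by (rule nn_integral_lower_bound[OF u \<beta>])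
  have "u \<in> L2_on \<Omega>" using u(1) by (auto simp: W12_0_def W12_def has_weak_gradient_L2_def)
  then have "u \<in> borel_measurable (lebesgue_on \<Omega>)" using L2_onD(1) \<Omega>_open_bounded(1) by blast
  then have "(\<lambda>x. u x powr (- \<beta>)) \<in> borel_measurable (lebesgue_on \<Omega>)" by measurable
  then have m: "(\<lambda>x. indicator \<Omega> x *\<^sub>R (u x powr (- \<beta>))) \<in> borel_measurable lebesgue"
    by (subst (asm) borel_measurable_restrict_space_iff) auto
  have J: "(\<integral>\<^sup>+x. ennreal (indicator \<Omega> x *\<^sub>R (u x powr (- \<beta>))) \<partial>lebesgue) = J"
    unfolding J_def by (intro nn_integral_cong) (simp add: indicator_def)
  have fin: "J < \<infinity>" using up by (rule le_less_trans) simp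
  show "set_integrable lebesgue \<Omega> (\<lambda>x. u x powr (- \<beta>))"
    unfolding set_integrable_def by (rule integrableI_nonneg[OF m]) (use J fin in auto)
  have I: "(LINT x:\<Omega>|lebesgue. u x powr (- \<beta>)) = enn2real J"
    unfolding set_lebesgue_integral_def J[symmetric] by (rule integral_eq_nn_integral[OF m]) auto
  have "enn2real J \<le> A + E" using up A0 E0 by (simp add: enn2real_leI)
  moreover have "A * (1 - (\<sigma>\<^sup>2) powr (1 - \<beta>)) \<le> enn2real J"
  proof -
    have "J = ennreal (enn2real J)" using fin by simp
    with lo have "ennreal (A * (1 - (\<sigma>\<^sup>2) powr (1 - \<beta>))) \<le> ennreal (enn2real J)" by (simp only:)
    then show ?thesis by (simp only: ennreal_le_iff[OF enn2real_nonneg])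
  qed
  moreover have "A * (\<sigma>\<^sup>2) powr (1 - \<beta>) \<le> A * ((pi\<^sup>2) powr (1 - \<beta>) * real N powr (\<beta> - 1))"
    by (rule mult_left_mono[OF error_bounds(1)[OF \<beta>] A0])
  moreover have "0 \<le> A * (\<sigma>\<^sup>2) powr (1 - \<beta>)" using A0 by simp
  moreover note error_bounds(2)[OF \<beta>, folded E_def]
  ultimately have "\<bar>enn2real J - A\<bar> \<le> A * ((pi\<^sup>2) powr (1 - \<beta>) * real N powr (\<beta> - 1))
    + 2 * pi * 8 powr \<beta> * 2 powr (1 - \<beta>) * (pi\<^sup>2) powr (1 - \<beta>) / (1 - \<beta>)\<^sup>2 * real N powr (\<beta> - 1)"
    using E0 unfolding right_diff_distrib abs_le_iff by linarith
  then show "\<bar>(LINT x:\<Omega>|lebesgue. u x powr (- \<beta>)) - 4 powr \<beta> * pi / (1 - \<beta>)\<bar>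
      \<le> (4 powr \<beta> * pi / (1 - \<beta>) * (pi\<^sup>2) powr (1 - \<beta>)
          + 2 * pi * 8 powr \<beta> * 2 powr (1 - \<beta>) * (pi\<^sup>2) powr (1 - \<beta>) / (1 - \<beta>)\<^sup>2) * real N powr (\<beta> - 1)"
    by (simp only: I A_def distrib_right mult.assoc)
qed

end

text \<open>The integrability conjunct excludes that an integral is merely the default value 0. The
  constant obtained depends on \<open>\<beta>\<close> alone, so the rotation may vary freely with
  \<open>N\<close>.\<close>

theorem proposition4p9:
  fixes \<theta> :: "nat \<Rightarrow> real" and \<Omega> :: "nat \<Rightarrow> (real ^ 2) set"
    and u :: "nat \<Rightarrow> real ^ 2 \<Rightarrow> real" and \<beta> :: real
  assumes "\<And>N. N \<ge> 3 \<Longrightarrow> \<Omega> N = regular_polygon (\<theta> N) N"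
    and "\<And>N. N \<ge> 3 \<Longrightarrow> u N \<in> W12_0 (\<Omega> N)"
    and "\<And>N. N \<ge> 3 \<Longrightarrow> weak_laplacian (\<Omega> N) (u N) (\<lambda>_. -1)"
    and "0 < \<beta>" and "\<beta> < 1"
  shows "(\<forall>N\<ge>3. set_integrable lebesgue (\<Omega> N) (\<lambda>x. u N x powr (-\<beta>))) \<and>
    (\<lambda>N. (LINT x:\<Omega> N|lebesgue. u N x powr (-\<beta>)) - 4 powr \<beta> * pi / (1 - \<beta>))
      \<in> O(\<lambda>N. real N powr (\<beta> - 1))"
proof -
  define K where "K = 4 powr \<beta> * pi / (1 - \<beta>) * (pi\<^sup>2) powr (1 - \<beta>)
    + 2 * pi * 8 powr \<beta> * 2 powr (1 - \<beta>) * (pi\<^sup>2) powr (1 - \<beta>) / (1 - \<beta>)\<^sup>2"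
  have est: "set_integrable lebesgue (\<Omega> N) (\<lambda>x. u N x powr (-\<beta>)) \<and>
      \<bar>(LINT x:\<Omega> N|lebesgue. u N x powr (- \<beta>)) - 4 powr \<beta> * pi / (1 - \<beta>)\<bar> \<le> K * real N powr (\<beta> - 1)"
    if N: "N \<ge> 3" for N
  proof -
    interpret polygon N "\<theta> N" by standard (rule N)
    have \<Omega>: "\<Omega> N = interior pgon" using assms(1)[OF N] by (simp only: regular_polygon_eq)
    show ?thesis
      using integral_estimate[OF assms(2,3)[OF N, unfolded \<Omega>] assms(4,5)] unfolding \<Omega> K_def by blast
  qed
  have "(\<lambda>N. (LINT x:\<Omega> N|lebesgue. u N x powr (-\<beta>)) - 4 powr \<beta> * pi / (1 - \<beta>))
      \<in> O(\<lambda>N. real N powr (\<beta> - 1))"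
    by (rule bigoI[of _ K]) (use est in \<open>auto intro!: eventually_sequentiallyI[of 3]\<close>)
  with est show ?thesis by blast
qed

end
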